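(* Let $T,T'\in\mathsf{SYT}(\lambda)$, $|\lambda|=N$, with $\alpha=\mathsf{Des}(T)$ of length $\ell$ and $\beta=\mathsf{Des}(T')$, and suppose $T\xrightarrow{I}T'$ is an edge of $\mathsf{CS}(\lambda)$ with $I=[i,i+2m]=I^-\cup\{i+m\}\cup I^+$, $I^-=[i,i+m-1]$, $I^+=[i+m+1,i+2m]$, and $I^-\cup\{i+m\}\subseteq\alpha^{(j)}$. Then the sequence of blocks of $\beta$ is $(\alpha^{(1)},\dots,\alpha^{(j-2)},\ast,\alpha^{(j+2)},\dots,\alpha^{(\ell)})$ where $\ast$ is determined as follows: (1) if $T$ is rectangle-free on $[i-1,i+2m]$ and on $[i,i+2m+1]$, then the edge is length-preserving and $\ast=(\alpha^{(j-1)},\ \alpha^{(j)}\setminus\{i+m\},\ \alpha^{(j+1)}\cup\{i+m\})$; (2) if $T$ has a rectangle on $[i,i+2m+1]$, then the edge is length-increasing and $\ast=(\alpha^{(j-1)},\ \alpha^{(j)}\setminus\{i+m\},\ I^+\cup\{i+m\},\ \alpha^{(j+1)}\setminus I^+)$; (3) if $T$ has a rectangle on $[i-1,i+2m]$, then $\alpha^{(j)}=I^-\cup\{i+m\}$, the edge is length-decreasing, and $\ast=(\alpha^{(j-1)}\cup I^-,\ \alpha^{(j+1)}\cup\{i+m\})$.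
   Context: French notation; $\mathsf{SYT}(\lambda)$ standard tableaux; $\mathsf{row}(T)$ reads rows left to right from top row to bottom row; $\mathsf{std}$ replaces the $a_j$ entries $j$, in reading order, by $a_1+\dots+a_{j-1}+1,\dots,a_1+\dots+a_j$. Crystal operator $f_i$: in the subword of letters $i,i+1$, bracket each $i+1$ with an unbracketed $i$ to its right (parenthesis matching); $f_i$ changes the rightmost unbracketed $i$ to $i+1$. For a permutation $\pi$ of $[N]$ and $I=[i,i+2m]\subseteq[N]$, $m\ge1$, $I$ is a Dyck pattern interval of $\pi$ if the RSK insertion tableau of the subword $\pi|_I$ has bottom row $i,\dots,i+m$ and top row $i+m+1,\dots,i+2m$; a Dyck pattern interval of $T$ is one of $\mathsf{row}(T)$. The crystal skeleton $\mathsf{CS}(\lambda)$ is the directed graph on $\mathsf{SYT}(\lambda)$ with, for each Dyck pattern interval $I=[i,i+2m]$ of $T$, an edge $T\xrightarrow{I}\mathsf{std}(f_i(b))$, where $b$ is obtained from $T$ by replacing entries $i,\dots,i+m$ by $i$ and $i+m+1,\dots,i+2m$ by $i+1$. Descent composition: $d$ is a descent of $T$ if $d+1$ lies in a strictly higher row; for descents $d_1<\dots<d_k$, $\mathsf{Des}(T)=(d_1,d_2-d_1,\dots,N-d_k)$; a composition $\alpha=(\alpha_1,\dots,\alpha_\ell)$ is identified with its blocks $\alpha^{(j)}=\{\alpha_1+\dots+\alpha_{j-1}+1,\dots,\alpha_1+\dots+\alpha_j\}$, and blocks with index outside $[1,\ell]$ are empty and omitted. For an interval $[a,b]\subseteq[1,N]$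 of length $2m'$, $T$ has a rectangle on $[a,b]$ if the jeu de taquin rectification of the skew tableau formed by the entries of $T$ in $[a,b]$ has shape $(m',m')$; otherwise (including when $[a,b]\not\subseteq[1,N]$) $T$ is rectangle-free on $[a,b]$. *)

theory Defs
  imports Main
begin

text \<open>A tableau is a list of rows, listed from the bottom row (index 0) upwards
(French notation).  The cell (r,c) is column c of row r.\<close>

type_synonym tableau = "nat list list"

definition is_partition :: "nat list \<Rightarrow> bool" where
  "is_partition lam \<longleftrightarrow> (\<forall>x\<in>set lam. 0 < x) \<and> sorted_wrt (\<ge>) lam"

definition is_SYT :: "nat list \<Rightarrow> tableau \<Rightarrow> bool" where
  "is_SYT lam T \<longleftrightarrow>
     is_partition lam \<and> map length T = lam \<and>
     distinct (concat T) \<and> set (concat T) = {1..sum_list lam} \<and>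
     (\<forall>R\<in>set T. sorted_wrt (<) R) \<and>
     (\<forall>r c. Suc r < length T \<and> c < length (T ! Suc r) \<longrightarrow> T ! r ! c < T ! Suc r ! c)"

definition rowword :: "tableau \<Rightarrow> nat list" where
  "rowword T = concat (rev T)"

fun split_lens :: "nat list \<Rightarrow> 'a list \<Rightarrow> 'a list list" where
  "split_lens [] w = []"
| "split_lens (l # ls) w = take l w # split_lens ls (drop l w)"

definition unrow :: "nat list \<Rightarrow> nat list \<Rightarrow> tableau" where
  "unrow lam w = rev (split_lens (rev lam) w)"

text \<open>Standardization: the occurrences of each letter, in reading order, are replaced
by consecutive integers, letters ordered by value.\<close>
definition std :: "nat list \<Rightarrow> nat list" where
  "std w = map (\<lambda>k. card {p. p < length w \<and> w ! p < w ! k}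
                    + card {p. p < k \<and> w ! p = w ! k} + 1) [0..<length w]"

definition row_ins :: "nat \<Rightarrow> nat list \<Rightarrow> nat list \<times> nat option" where
  "row_ins x R = (let k = length (takeWhile (\<lambda>y. y \<le> x) R) in
     if k = length R then (R @ [x], None) else (R[k := x], Some (R ! k)))"

fun rsk_ins :: "nat \<Rightarrow> tableau \<Rightarrow> tableau" where
  "rsk_ins x [] = [[x]]"
| "rsk_ins x (R # Rs) = (case row_ins x R of
      (R', None) \<Rightarrow> R' # Rs
    | (R', Some y) \<Rightarrow> R' # rsk_ins y Rs)"

definition rsk_P :: "nat list \<Rightarrow> tableau" where
  "rsk_P w = foldl (\<lambda>P x. rsk_ins x P) [] w"

definition dyck_interval :: "nat list \<Rightarrow> nat \<Rightarrow> nat \<Rightarrow> bool" where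
  "dyck_interval \<pi> i m \<longleftrightarrow> 1 \<le> m \<and> 1 \<le> i \<and> i + 2*m \<le> length \<pi> \<and>
     rsk_P (filter (\<lambda>x. x \<in> {i..i+2*m}) \<pi>) = [[i..<i+m+1], [i+m+1..<i+2*m+1]]"

text \<open>Positions of unbracketed letters i (each i+1 is bracketed with an unbracketed i
to its right, by parenthesis matching).\<close>
fun unbr :: "nat \<Rightarrow> nat \<Rightarrow> nat \<Rightarrow> nat list \<Rightarrow> nat list" where
  "unbr i pos c [] = []"
| "unbr i pos c (x # xs) =
     (if x = Suc i then unbr i (Suc pos) (Suc c) xs
      else if x = i then (if 0 < c then unbr i (Suc pos) (c - 1) xs
                          else pos # unbr i (Suc pos) c xs)
      else unbr i (Suc pos) c xs)"

definition crystal_f :: "nat \<Rightarrow> nat list \<Rightarrow> nat list option" where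
  "crystal_f i w = (let U = unbr i 0 0 w in
     if U = [] then None else Some (w[last U := Suc i]))"

definition cs_edge :: "nat list \<Rightarrow> tableau \<Rightarrow> nat \<Rightarrow> nat \<Rightarrow> tableau \<Rightarrow> bool" where
  "cs_edge lam T i m T' \<longleftrightarrow> is_SYT lam T \<and> is_SYT lam T' \<and>
     dyck_interval (rowword T) i m \<and>
     (let b = map (map (\<lambda>x. if x \<in> {i..i+m} then i
                            else if x \<in> {i+m+1..i+2*m} then Suc i else x)) T
      in \<exists>w. crystal_f i (rowword b) = Some w \<and> T' = unrow lam (std w))"

definition row_of :: "tableau \<Rightarrow> nat \<Rightarrow> nat" where
  "row_of T v = (THE r. r < length T \<and> v \<in> set (T ! r))"

definition descents :: "tableau \<Rightarrow> nat set" where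
  "descents T = {d. 1 \<le> d \<and> Suc d \<le> length (concat T) \<and> row_of T d < row_of T (Suc d)}"

definition Des :: "tableau \<Rightarrow> nat list" where
  "Des T = (let pts = 0 # sorted_list_of_set (descents T) @ [length (concat T)]
            in map (\<lambda>k. pts ! Suc k - pts ! k) [0..<length pts - 1])"

definition blk :: "nat list \<Rightarrow> nat \<Rightarrow> nat set" where
  "blk \<alpha> j = (if 1 \<le> j \<and> j \<le> length \<alpha>
              then {sum_list (take (j - 1) \<alpha>) + 1 .. sum_list (take j \<alpha>)} else {})"

definition blocks :: "nat list \<Rightarrow> nat set list" where
  "blocks \<alpha> = map (blk \<alpha>) [1..<length \<alpha> + 1]"

type_synonym filling = "nat \<times> nat \<Rightarrow> nat option"

definition cell :: "tableau \<Rightarrow> filling" where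
  "cell T = (\<lambda>(r, c). if r < length T \<and> c < length (T ! r) then Some (T ! r ! c) else None)"

inductive slide :: "filling \<Rightarrow> nat \<times> nat \<Rightarrow> filling \<Rightarrow> bool" where
  stop: "F (r, Suc c) = None \<Longrightarrow> F (Suc r, c) = None \<Longrightarrow> slide F (r, c) F"
| right: "F (r, Suc c) = Some x \<Longrightarrow> (\<forall>y. F (Suc r, c) = Some y \<longrightarrow> x < y) \<Longrightarrow>
    slide (F((r, c) := Some x, (r, Suc c) := None)) (r, Suc c) F' \<Longrightarrow> slide F (r, c) F'"
| up: "F (Suc r, c) = Some y \<Longrightarrow> (\<forall>x. F (r, Suc c) = Some x \<longrightarrow> y < x) \<Longrightarrow>
    slide (F((r, c) := Some y, (Suc r, c) := None)) (Suc r, c) F' \<Longrightarrow> slide F (r, c) F'"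

inductive jdt_step :: "(nat \<times> nat) set \<times> filling \<Rightarrow> (nat \<times> nat) set \<times> filling \<Rightarrow> bool" where
  "(r, c) \<in> \<mu> \<Longrightarrow> (r, Suc c) \<notin> \<mu> \<Longrightarrow> (Suc r, c) \<notin> \<mu> \<Longrightarrow> slide F (r, c) F' \<Longrightarrow>
   jdt_step (\<mu>, F) (\<mu> - {(r, c)}, F')"

text \<open>T has a rectangle on [a,b] (length 2m'): [a,b] inside [1,N] and the rectification
of the skew tableau formed by the entries of T in [a,b] has shape (m',m').\<close>
definition has_rect :: "tableau \<Rightarrow> nat \<Rightarrow> nat \<Rightarrow> bool" where
  "has_rect T a b \<longleftrightarrow> 1 \<le> a \<and> a \<le> b \<and> b \<le> length (concat T) \<and> even (b + 1 - a) \<and>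
     (let F0 = (\<lambda>p. case cell T p of Some v \<Rightarrow> if a \<le> v \<and> v \<le> b then Some v else None
                                 | None \<Rightarrow> None);
          \<mu>0 = {p. \<exists>v. cell T p = Some v \<and> v < a}
      in \<exists>F'. jdt_step\<^sup>*\<^sup>* (\<mu>0, F0) ({}, F') \<and>
              {p. F' p \<noteq> None} = {(r, c). r < 2 \<and> c < (b + 1 - a) div 2})"

end

theory Submission
  imports Defs
begin

text \<open>Only the relative positions of the entries of $T$ in its reading word matter: $d$ is a descent iff
$d+1$ is read before $d$. Write $a_j = i+j$ for $0 \le j \le m$ and $b_j = i+m+j$ for $1 \le j \le m$.
Running RSK backwards from the prescribed tableau shows that the $a$'s and the $b$'s are each read in
increasing order and that there is a unique unbracketed $a_k$, with $b_{j+1}$ before $a_j$ for $j < k$,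
$a_k$ before $b_{k+1}$, and $b_j$ before $a_j$ for $j > k$. The edge relabels the entries by a cycle on
$[i+k, i+m+k]$, so apart from moving the descent $i+m$ to $i+m-1$ it can only destroy the descent $i-1$
(when $k = 0$ and $i$, $i-1$, $i+1$ are read in this order) or create the descent $i+2m$ (when $k = m$ and
$i+2m$, $i+2m+1$, $i+m$ are read in this order).

Jeu de taquin slides preserve the existence of increasing subsequences of given length and of decreasing
subsequences of length three in the reading word. Hence $T$ has a rectangle on an interval of length $2n$
iff the subword on it has no increasing subsequence of length $n+1$ and no decreasing one of length $3$,
and for the two intervals of the theorem this is exactly the respective exceptional condition.\<close>

subsection \<open>Chains under jeu de taquin slides\<close>

text \<open>\<open>has_rect\<close> asks for one rectification of the right shape. Refuting a
  rectangle therefore needs all sequences of slides to agree, and asserting one needs some sequence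
  to terminate. Two statistics suffice because a tableau with 2n entries has shape (n,n) as soon as
  it has at most two rows and at most n columns: a column reaching a third row gives a decreasing
  triple, and a bottom row longer than n gives a long increasing subsequence. The statistics are
  expressed through the row of each value instead of its reading position; then a move to the right
  changes nothing and a move upwards changes the row of a single value.

  For the intervals of the theorem n = m+1, so the chains to exclude have m+2 elements. They are
  excluded by pigeonhole, since the bracketing splits the interval into m+1 pairs read in the wrong
  order: (i-1, a_0) and (a_j, b_j) for 1 <= j <= m with the left neighbour i-1; (a_j, b_{j+1}) for j
  < m and (a_m, i+2m+1) with the right neighbour i+2m+1.\<close>

definition cell_le :: "nat \<times> nat \<Rightarrow> nat \<times> nat \<Rightarrow> bool" where
  "cell_le p q \<longleftrightarrow> fst p \<le> fst q \<and> snd p \<le> snd q"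

definition lower_set :: "(nat \<times> nat) set \<Rightarrow> bool" where
  "lower_set A \<longleftrightarrow> (\<forall>p q. q \<in> A \<longrightarrow> cell_le p q \<longrightarrow> p \<in> A)"

definition standard_filling :: "filling \<Rightarrow> bool" where
  "standard_filling F \<longleftrightarrow> finite (dom F) \<and>
     (\<forall>p q v. F p = Some v \<longrightarrow> F q = Some v \<longrightarrow> p = q) \<and>
     (\<forall>p q x y. F p = Some x \<longrightarrow> F q = Some y \<longrightarrow> cell_le p q \<longrightarrow> p \<noteq> q \<longrightarrow> x < y)"

definition value_row :: "filling \<Rightarrow> nat \<Rightarrow> nat" where
  "value_row F v = (THE r. \<exists>c. F (r, c) = Some v)"

text \<open>For a set of values, values weakly descending in rows form an increasing
subsequence of the reading word, values strictly ascending in rows a decreasing one.\<close>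

definition inc_chain :: "nat set \<Rightarrow> (nat \<Rightarrow> nat) \<Rightarrow> nat \<Rightarrow> bool" where
  "inc_chain V \<rho> n \<longleftrightarrow> (\<exists>S\<subseteq>V. card S = n \<and> (\<forall>x\<in>S. \<forall>y\<in>S. x < y \<longrightarrow> \<rho> y \<le> \<rho> x))"

definition dec_triple :: "nat set \<Rightarrow> (nat \<Rightarrow> nat) \<Rightarrow> bool" where
  "dec_triple V \<rho> \<longleftrightarrow> (\<exists>x\<in>V. \<exists>y\<in>V. \<exists>z\<in>V. x < y \<and> y < z \<and> \<rho> x < \<rho> y \<and> \<rho> y < \<rho> z)"

lemma inc_chain_cong: "(\<And>v. v \<in> V \<Longrightarrow> \<rho> v = \<rho>' v) \<Longrightarrow> inc_chain V \<rho> n = inc_chain V \<rho>' n"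
  unfolding inc_chain_def by (intro ex_cong1 conj_cong refl) (metis subsetD)+

lemma dec_triple_cong: "(\<And>v. v \<in> V \<Longrightarrow> \<rho> v = \<rho>' v) \<Longrightarrow> dec_triple V \<rho> = dec_triple V \<rho>'"
  unfolding dec_triple_def by auto

text \<open>When the hole moves up, \<open>y\<close> drops from row \<open>Suc r\<close> to row \<open>r\<close>: a chain through \<open>y\<close> that is broken by the move
is repaired by exchanging entries with their neighbours \<open>\<phi>\<close> above (left of \<open>y\<close>) or \<open>\<psi>\<close> below
(right of \<open>y\<close>).\<close>

locale row_drop =
  fixes V :: "nat set" and \<rho> :: "nat \<Rightarrow> nat" and y r :: nat and \<phi> \<psi> :: "nat \<Rightarrow> nat"
  assumes y: "y \<in> V" "\<rho> y = Suc r"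
    and phi: "\<And>u. u \<in> V \<Longrightarrow> \<rho> u = r \<Longrightarrow> u < y \<Longrightarrow> \<phi> u \<in> V \<and> \<rho> (\<phi> u) = Suc r \<and> u < \<phi> u \<and> \<phi> u < y"
    and phi_mono: "\<And>u v. u \<in> V \<Longrightarrow> v \<in> V \<Longrightarrow> \<rho> u = r \<Longrightarrow> \<rho> v = r \<Longrightarrow> u < v \<Longrightarrow> v < y \<Longrightarrow> \<phi> u < \<phi> v"
    and psi: "\<And>z. z \<in> V \<Longrightarrow> \<rho> z = Suc r \<Longrightarrow> y < z \<Longrightarrow> \<psi> z \<in> V \<and> \<rho> (\<psi> z) = r \<and> y < \<psi> z \<and> \<psi> z < z"
    and psi_mono: "\<And>u v. u \<in> V \<Longrightarrow> v \<in> V \<Longrightarrow> \<rho> u = Suc r \<Longrightarrow> \<rho> v = Suc r \<Longrightarrow> y < u \<Longrightarrow> u < v \<Longrightarrow> \<psi> u < \<psi> v"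
begin

text \<open>After the drop \<open>y\<close> conflicts only with the larger members of
  \<open>S\<close> in row \<open>Suc r\<close>. All of these are replaced by their
  \<open>\<psi>\<close>. The cardinality is kept because \<open>\<psi> z\<close>, smaller than
  \<open>z\<close> and in row \<open>r\<close>, cannot already belong to \<open>S\<close>.\<close>

lemma inc_chain_drop:
  assumes "inc_chain V \<rho> n" shows "inc_chain V (\<rho>(y := r)) n"
proof -
  obtain S where S: "S \<subseteq> V" "card S = n" "\<And>x z. x \<in> S \<Longrightarrow> z \<in> S \<Longrightarrow> x < z \<Longrightarrow> \<rho> z \<le> \<rho> x"
    using assms unfolding inc_chain_def by blast
  show ?thesis
  proof (cases "y \<in> S")
    case False
    then show ?thesis unfolding inc_chain_def using S by (intro exI[of _ S]) auto
  next
    case True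
    define mv where "mv z \<longleftrightarrow> \<rho> z = Suc r \<and> y < z" for z
    define g where "g z = (if mv z then \<psi> z else z)" for z
    have mvD: "\<psi> z \<in> V \<and> \<rho> (\<psi> z) = r \<and> y < \<psi> z \<and> \<psi> z < z \<and> \<psi> z \<notin> S" if "z \<in> S" "mv z" for z
    proof -
      have *: "\<psi> z \<in> V \<and> \<rho> (\<psi> z) = r \<and> y < \<psi> z \<and> \<psi> z < z" using psi[of z] that S(1) mv_def by auto
      have "\<psi> z \<notin> S" using S(3)[of "\<psi> z" z] * that mv_def by auto
      with * show ?thesis by auto
    qed
    have fixrow: "\<rho> z \<le> r" if "z \<in> S" "\<not> mv z" "y < z" for z
      using S(3)[OF True that(1) that(3)] y that mv_def by force
    have "inj_on g S"
    proof (rule inj_onI)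
      fix s t assume a: "s \<in> S" "t \<in> S" "g s = g t"
      show "s = t"
      proof (cases "mv s \<and> mv t")
        case True
        then show ?thesis using psi_mono[of s t] psi_mono[of t s] a S(1) unfolding g_def mv_def
          by (metis linorder_neqE_nat nat_neq_iff subsetD)
      next
        case False
        then show ?thesis using a mvD unfolding g_def by (metis)
      qed
    qed
    then have c: "card (g ` S) = n" using S(2) card_image by blast
    have sub: "g ` S \<subseteq> V" using mvD S(1) unfolding g_def by auto
    have "(\<rho>(y := r)) q \<le> (\<rho>(y := r)) p" if pq: "p \<in> g ` S" "q \<in> g ` S" "p < q" for p q
    proof -
      obtain s t where st: "s \<in> S" "t \<in> S" "p = g s" "q = g t" using pq by auto
      consider "mv s" "mv t" | "mv s" "\<not> mv t" | "\<not> mv s" "mv t" | "\<not> mv s" "\<not> mv t" by blast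
      then show ?thesis
      proof cases
        case 1 then show ?thesis using st mvD[of s] mvD[of t] g_def by auto
      next
        case 2
        then show ?thesis using st mvD[of s] fixrow[of t] g_def pq(3) by auto
      next
        case 3
        then have "s < t" using st mvD[of t] g_def pq(3) by auto
        then have "\<rho> t \<le> \<rho> s" using S(3) st by auto
        then show ?thesis using 3 st mvD[of t] g_def mv_def by auto
      next
        case 4
        then have lt: "s < t" using st g_def pq(3) by auto
        then have "\<rho> t \<le> \<rho> s" using S(3) st by auto
        then show ?thesis using 4 lt st fixrow[of t] g_def y by auto
      qed
    qed
    then show ?thesis unfolding inc_chain_def using c sub by (intro exI[of _ "g ` S"]) blast
  qed
qed

text \<open>Dual exchange: raising \<open>y\<close> back conflicts only with smaller members in row
  \<open>r\<close>, and these move up along \<open>\<phi>\<close>.\<close>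

lemma inc_chain_undrop:
  assumes "inc_chain V (\<rho>(y := r)) n" shows "inc_chain V \<rho> n"
proof -
  obtain S where S: "S \<subseteq> V" "card S = n"
    "\<And>x z. x \<in> S \<Longrightarrow> z \<in> S \<Longrightarrow> x < z \<Longrightarrow> (\<rho>(y := r)) z \<le> (\<rho>(y := r)) x"
    using assms unfolding inc_chain_def by blast
  show ?thesis
  proof (cases "y \<in> S")
    case False
    then show ?thesis unfolding inc_chain_def using S
      by (intro exI[of _ S]) (metis fun_upd_apply)
  next
    case True
    define mv where "mv z \<longleftrightarrow> \<rho> z = r \<and> z < y" for z
    define g where "g z = (if mv z then \<phi> z else z)" for z
    have mvD: "\<phi> z \<in> V \<and> \<rho> (\<phi> z) = Suc r \<and> \<phi> z < y \<and> z < \<phi> z \<and> \<phi> z \<notin> S" if "z \<in> S" "mv z" for z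
    proof -
      have *: "\<phi> z \<in> V \<and> \<rho> (\<phi> z) = Suc r \<and> \<phi> z < y \<and> z < \<phi> z" using phi[of z] that S(1) mv_def by auto
      have "\<phi> z \<notin> S" using S(3)[of z "\<phi> z"] * that mv_def by auto
      with * show ?thesis by auto
    qed
    have fixrow: "Suc r \<le> \<rho> z" if "z \<in> S" "\<not> mv z" "z < y" for z
      using S(3)[OF that(1) True that(3)] y that mv_def by force
    have "inj_on g S"
    proof (rule inj_onI)
      fix s t assume a: "s \<in> S" "t \<in> S" "g s = g t"
      show "s = t"
      proof (cases "mv s \<and> mv t")
        case True
        then show ?thesis using phi_mono[of s t] phi_mono[of t s] a S(1) unfolding g_def mv_def
          by (metis linorder_neqE_nat nat_neq_iff subsetD)
      next
        case False
        then show ?thesis using a mvD unfolding g_def by (metis)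
      qed
    qed
    then have c: "card (g ` S) = n" using S(2) card_image by blast
    have sub: "g ` S \<subseteq> V" using mvD S(1) unfolding g_def by auto
    have "\<rho> q \<le> \<rho> p" if pq: "p \<in> g ` S" "q \<in> g ` S" "p < q" for p q
    proof -
      obtain s t where st: "s \<in> S" "t \<in> S" "p = g s" "q = g t" using pq by auto
      consider "mv s" "mv t" | "mv s" "\<not> mv t" | "\<not> mv s" "mv t" | "\<not> mv s" "\<not> mv t" by blast
      then show ?thesis
      proof cases
        case 1 then show ?thesis using st mvD[of s] mvD[of t] g_def by auto
      next
        case 2
        then have "s < t" using st mvD[of s] g_def pq(3) by auto
        then have "(\<rho>(y := r)) t \<le> (\<rho>(y := r)) s" using S(3) st by auto
        then show ?thesis using 2 st mvD[of s] g_def pq(3) y mv_def by (auto split: if_splits)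
      next
        case 3
        then show ?thesis using st mvD[of t] fixrow[of s] g_def pq(3) by auto
      next
        case 4
        then have lt: "s < t" using st g_def pq(3) by auto
        then have "(\<rho>(y := r)) t \<le> (\<rho>(y := r)) s" using S(3) st by auto
        then show ?thesis using 4 lt st fixrow[of s] g_def y by (auto split: if_splits)
      qed
    qed
    then show ?thesis unfolding inc_chain_def using c sub by (intro exI[of _ "g ` S"]) blast
  qed
qed

text \<open>Only a pair \<open>u < y\<close> with \<open>u\<close> in row \<open>r\<close> loses its
  strict ascent. Here \<open>y\<close> itself is exchanged, for \<open>\<phi> u\<close>, which stays
  in row \<open>Suc r\<close> and lies between \<open>u\<close> and \<open>y\<close>.\<close>

lemma dec_triple_drop:
  assumes "dec_triple V \<rho>" shows "dec_triple V (\<rho>(y := r))"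
proof -
  obtain p q s where a: "p \<in> V" "q \<in> V" "s \<in> V" "p < q" "q < s" "\<rho> p < \<rho> q" "\<rho> q < \<rho> s"
    using assms unfolding dec_triple_def by auto
  have I: "dec_triple V (\<rho>(y := r))" if "p \<in> V" "q \<in> V" "s \<in> V" "p < q" "q < s"
     "(\<rho>(y := r)) p < (\<rho>(y := r)) q" "(\<rho>(y := r)) q < (\<rho>(y := r)) s" for p q s
    using that unfolding dec_triple_def by blast
  consider "s = y" "\<rho> q = r" | "q = y" "\<rho> p = r" | "s = y" "\<rho> q \<noteq> r" | "q = y" "\<rho> p \<noteq> r" | "s \<noteq> y" "q \<noteq> y" by blast
  then show ?thesis
  proof cases
    case 1 then show ?thesis using I[of p q "\<phi> q"] phi[of q] a y by auto
  next
    case 2 then show ?thesis using I[of p "\<phi> p" s] phi[of p] a y by auto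
  next
    case 3 then show ?thesis using I[of p q s] a y by auto
  next
    case 4 then show ?thesis using I[of p q s] a y by auto
  next
    case 5 then show ?thesis using I[of p q s] a y by (cases "p = y") auto
  qed
qed

text \<open>Dually, \<open>y\<close> followed by some \<open>z\<close> in row \<open>Suc r\<close>
  is exchanged for \<open>\<psi> z\<close>.\<close>

lemma dec_triple_undrop:
  assumes "dec_triple V (\<rho>(y := r))" shows "dec_triple V \<rho>"
proof -
  obtain p q s where a: "p \<in> V" "q \<in> V" "s \<in> V" "p < q" "q < s"
    "(\<rho>(y := r)) p < (\<rho>(y := r)) q" "(\<rho>(y := r)) q < (\<rho>(y := r)) s"
    using assms unfolding dec_triple_def by auto
  have I: "dec_triple V \<rho>" if "p \<in> V" "q \<in> V" "s \<in> V" "p < q" "q < s" "\<rho> p < \<rho> q" "\<rho> q < \<rho> s" for p q s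
    using that unfolding dec_triple_def by blast
  consider "p = y" "\<rho> q = Suc r" | "q = y" "\<rho> s = Suc r" | "p = y" "\<rho> q \<noteq> Suc r"
    | "q = y" "\<rho> s \<noteq> Suc r" | "p \<noteq> y" "q \<noteq> y" by blast
  then show ?thesis
  proof cases
    case 1 then show ?thesis using I[of "\<psi> q" q s] psi[of q] a y by auto
  next
    case 2 then show ?thesis using I[of p "\<psi> s" s] psi[of s] a y by auto
  next
    case 3 then show ?thesis using I[of p q s] a y by auto
  next
    case 4 then show ?thesis using I[of p q s] a y by auto
  next
    case 5 then show ?thesis using I[of p q s] a y by (auto split: if_splits)
  qed
qed

end

lemma value_row_eq:
  assumes "standard_filling F" "F (r, c) = Some v"
  shows "value_row F v = r"
  unfolding value_row_def
proof (rule the_equality)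
  show "\<exists>c. F (r, c) = Some v" using assms by auto
next
  fix r' assume "\<exists>c. F (r', c) = Some v"
  then show "r' = r" using assms unfolding standard_filling_def by (metis prod.inject)
qed

lemma standard_filling_less:
  assumes "standard_filling F" "F p = Some x" "F q = Some y" "cell_le p q" "p \<noteq> q"
  shows "x < y"
  using assms unfolding standard_filling_def by blast

text \<open>\<open>M\<close> is the part of the inner shape still to be vacated, \<open>h\<close> the current hole.\<close>

definition slide_state :: "(nat \<times> nat) set \<Rightarrow> filling \<Rightarrow> nat \<times> nat \<Rightarrow> bool" where
  "slide_state M F h \<longleftrightarrow> standard_filling F \<and> lower_set M \<and> lower_set (M \<union> dom F \<union> {h}) \<and>
     M \<inter> dom F = {} \<and> h \<notin> M \<and> h \<notin> dom F"

lemma slide_state_convex: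
  assumes "slide_state M F h" "p \<in> dom F \<union> {h}" "s \<in> dom F \<union> {h}" "cell_le p q" "cell_le q s"
  shows "q \<in> dom F \<union> {h}"
proof -
  have "q \<in> M \<union> dom F \<union> {h}" using assms unfolding slide_state_def lower_set_def by blast
  moreover have "q \<notin> M" using assms unfolding slide_state_def lower_set_def by blast
  ultimately show ?thesis by auto
qed

text \<open>Convexity of the skew shape fills one of the two neighbours of the hole on the way to
  \<open>q\<close>. Hence the smaller neighbour, the one that slides, is minimal among all entries
  weakly above and to the right of the hole.\<close>

lemma slide_state_above_hole:
  assumes st: "slide_state M F (r, c)" and q: "F q = Some v" "cell_le (r, c) q"
  obtains x where "F (r, Suc c) = Some x" "x \<le> v" | y where "F (Suc r, c) = Some y" "y \<le> v"
proof -
  have sf: "standard_filling F" using st slide_state_def by auto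
  have ne: "q \<noteq> (r, c)" using st q unfolding slide_state_def by auto
  obtain r' c' where rc: "q = (r', c')" by (cases q)
  consider "Suc c \<le> c'" | "Suc r \<le> r'" "c' = c" using ne q(2) rc unfolding cell_le_def by fastforce
  then show ?thesis
  proof cases
    case 1
    then have "(r, Suc c) \<in> dom F \<union> {(r, c)}"
      using slide_state_convex[OF st, of "(r, c)" q "(r, Suc c)"] q rc unfolding cell_le_def by auto
    then obtain x where x: "F (r, Suc c) = Some x" by auto
    then have "x \<le> v" using standard_filling_less[OF sf x q(1)] 1 q rc unfolding cell_le_def by force
    then show ?thesis using that(1) x by blast
  next
    case 2
    then have "(Suc r, c) \<in> dom F \<union> {(r, c)}"
      using slide_state_convex[OF st, of "(r, c)" q "(Suc r, c)"] q rc unfolding cell_le_def by auto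
    then obtain y where y: "F (Suc r, c) = Some y" by auto
    then have "y \<le> v" using standard_filling_less[OF sf y q(1)] 2 q rc unfolding cell_le_def by force
    then show ?thesis using that(2) y by blast
  qed
qed

text \<open>Minimality of the moved entry keeps the filling standard whatever the direction, so
  moves to the right and upwards are both instances.\<close>

lemma slide_state_move:
  assumes st: "slide_state M F h" and h': "F h' = Some x" "cell_le h h'"
    and min: "\<forall>q v. F q = Some v \<longrightarrow> cell_le h q \<longrightarrow> x \<le> v"
  shows "slide_state M (F(h := Some x, h' := None)) h'"
    and "ran (F(h := Some x, h' := None)) = ran F"
    and "\<And>v. v \<in> ran F \<Longrightarrow>
      value_row (F(h := Some x, h' := None)) v = (if v = x then fst h else value_row F v)"
proof -
  let ?G = "F(h := Some x, h' := None)"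
  have sf: "standard_filling F" and hn: "F h = None" and ne: "h \<noteq> h'"
    using st h' unfolding slide_state_def by auto
  have inj: "p = q" if "F p = Some v" "F q = Some v" for p q v
    using sf that unfolding standard_filling_def by blast
  have min': "x < v" if "F q = Some v" "cell_le h q" "q \<noteq> h'" for q v
    using min that inj[OF that(1), of h'] h'(1) by (metis le_neq_implies_less)
  have dm: "dom ?G \<union> {h'} = dom F \<union> {h}" using h' by auto
  have G: "?G p = Some v \<longleftrightarrow> (p = h \<and> v = x) \<or> (p \<noteq> h \<and> p \<noteq> h' \<and> F p = Some v)" for p v
    using ne by auto
  have "v < w" if pq: "?G p = Some v" "?G q = Some w" "cell_le p q" "p \<noteq> q" for p q v w
  proof -
    have "(p = h \<and> v = x) \<or> (p \<noteq> h \<and> p \<noteq> h' \<and> F p = Some v)" using pq(1) unfolding G .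
    moreover have "(q = h \<and> w = x) \<or> (q \<noteq> h \<and> q \<noteq> h' \<and> F q = Some w)" using pq(2) unfolding G .
    ultimately consider "p = h" "v = x" "q \<noteq> h'" "F q = Some w" | "q = h" "w = x" "p \<noteq> h'" "F p = Some v"
      | "F p = Some v" "F q = Some w" using pq(4) by fast
    then show ?thesis
    proof cases
      case 1 then show ?thesis using min' pq by blast
    next
      case 2 then show ?thesis using standard_filling_less[OF sf, of p v h' x] h' pq
        unfolding cell_le_def by force
    next
      case 3 then show ?thesis using standard_filling_less[OF sf] pq by blast
    qed
  qed
  moreover have "p = q" if "?G p = Some v" "?G q = Some v" for p q v
    using that[unfolded G] inj[of _ v] h'(1) by blast
  moreover have "finite (dom ?G)" using sf dm unfolding standard_filling_def
    by (metis finite.emptyI finite_Un finite_insert)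
  ultimately have sG: "standard_filling ?G" unfolding standard_filling_def by blast
  have hM: "h' \<notin> M" using st h' unfolding slide_state_def by auto
  show "slide_state M ?G h'"
    unfolding slide_state_def
  proof (intro conjI)
    show "lower_set (M \<union> dom ?G \<union> {h'})" using st dm unfolding slide_state_def by (metis Un_assoc)
    show "M \<inter> dom ?G = {}" using st dm unfolding slide_state_def by auto
  qed (use sG st hM in \<open>auto simp: slide_state_def\<close>)
  have "v \<in> ran ?G \<longleftrightarrow> v \<in> ran F" for v
    unfolding ran_def mem_Collect_eq G using h'(1) hn by (metis option.distinct(1) option.inject)
  then show rG: "ran ?G = ran F" by blast
  fix v assume "v \<in> ran F"
  then obtain p where p: "?G p = Some v" using rG[symmetric] unfolding ran_def by blast
  show "value_row ?G v = (if v = x then fst h else value_row F v)"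
  proof (cases "p = h")
    case True then show ?thesis using p ne value_row_eq[OF sG, of "fst h" "snd h"] by auto
  next
    case False
    then have "F p = Some v" "p \<noteq> h'" using p G by auto
    moreover from this have "v \<noteq> x" using inj h' by blast
    ultimately show ?thesis using value_row_eq[OF sG, of "fst p" "snd p" v] p
        value_row_eq[OF sf, of "fst p" "snd p" v] by simp
  qed
qed

text \<open>Here \<open>\<phi>\<close> goes one cell up and \<open>\<psi>\<close> one cell down in
  the same column. Entries of row \<open>r\<close> smaller than \<open>y\<close> lie left of the
  hole and entries of row \<open>Suc r\<close> larger than \<open>y\<close> lie right of it, so
  convexity of the shape with the hole supplies the neighbouring cell.\<close>

lemma row_drop_slide_up:
  assumes st: "slide_state M F (r, c)" and y: "F (Suc r, c) = Some y"
    and x: "\<forall>x. F (r, Suc c) = Some x \<longrightarrow> y < x"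
  shows "row_drop (ran F) (value_row F) y r
     (\<lambda>u. the (F (Suc r, THE k. F (r, k) = Some u))) (\<lambda>z. the (F (r, THE k. F (Suc r, k) = Some z)))"
proof -
  have sf: "standard_filling F" and hn: "F (r, c) = None"
    using st unfolding slide_state_def by auto
  have inj: "p = q" if "F p = Some v" "F q = Some v" for p q v
    using sf that unfolding standard_filling_def by blast
  have less: "v < w" if "F (p, p') = Some v" "F (q, q') = Some w" "p \<le> q" "p' \<le> q'" "(p, p') \<noteq> (q, q')" for p p' q q' v w
    using standard_filling_less[OF sf that(1,2)] that(3-) unfolding cell_le_def by simp
  have col: "(THE k. F (q, k) = Some u) = k" if "F (q, k) = Some u" for q k u
    using that inj by (intro the_equality) auto
  have cell: "\<exists>k. F (q, k) = Some u" if "u \<in> ran F" "value_row F u = q" for u q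
  proof -
    obtain a b where "F (a, b) = Some u" using \<open>u \<in> ran F\<close> unfolding ran_def by auto
    then show ?thesis using value_row_eq[OF sf] that(2) by blast
  qed
  have conv: "\<exists>v. F (q, k) = Some v" if "F (a, b) = Some v1 \<or> (a, b) = (r, c)" "F (a', b') = Some v2 \<or> (a', b') = (r, c)"
     "a \<le> q" "q \<le> a'" "b \<le> k" "k \<le> b'" "(q, k) \<noteq> (r, c)" for a b a' b' q k v1 v2
    using slide_state_convex[OF st, of "(a, b)" "(a', b')" "(q, k)"] that unfolding cell_le_def by auto
  have right: "y < v" if "F (r, k) = Some v" "c \<le> k" for k v
  proof -
    have "cell_le (r, c) (r, k)" using that by (simp add: cell_le_def)
    then show ?thesis using that(1)
    proof (elim slide_state_above_hole[OF st that(1)])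
      fix x' assume "F (r, Suc c) = Some x'" "x' \<le> v" then show ?thesis using x by auto
    next
      fix y' assume "F (Suc r, c) = Some y'" "y' \<le> v"
      moreover have "F (Suc r, c) \<noteq> Some v" using inj[OF that(1), of "(Suc r, c)"] by auto
      ultimately show ?thesis using y by (auto simp: order_less_le)
    qed
  qed
  have P: "\<exists>k v. k < c \<and> F (r, k) = Some u \<and> F (Suc r, k) = Some v \<and> u < v \<and> v < y"
    if u: "u \<in> ran F" "value_row F u = r" "u < y" for u
  proof -
    obtain k where k: "F (r, k) = Some u" using cell[OF u(1,2)] by blast
    have kc: "k < c" using right[OF k] u(3) by force
    obtain v where v: "F (Suc r, k) = Some v" using conv[of r k u "Suc r" c y "Suc r" k] k kc y by auto
    show ?thesis using k kc v less[OF k v] less[OF v y] by auto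
  qed
  have Q: "\<exists>k v. c < k \<and> F (Suc r, k) = Some z \<and> F (r, k) = Some v \<and> y < v \<and> v < z"
    if z: "z \<in> ran F" "value_row F z = Suc r" "y < z" for z
  proof -
    obtain k where k: "F (Suc r, k) = Some z" using cell[OF z(1,2)] by blast
    have kc: "c < k"
    proof (rule ccontr)
      assume "\<not> c < k"
      then show False using less[OF k y] z(3) k y by (cases "k = c") auto
    qed
    \<comment> \<open>The hole serves as one endpoint, so the value \<open>0\<close> is a
      dummy.\<close>
    obtain v where v: "F (r, k) = Some v" using conv[of r c 0 "Suc r" k z r k] k kc y by auto
    show ?thesis using k kc v less[OF v k] right[OF v] by auto
  qed
  have ranI: "F p = Some v \<Longrightarrow> v \<in> ran F" for p v by (rule ranI)
  show ?thesis
  proof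
    show "y \<in> ran F" "value_row F y = Suc r" using y ranI value_row_eq[OF sf] by blast+
  next
    fix u assume "u \<in> ran F" "value_row F u = r" "u < y"
    from P[OF this] obtain k v where *: "F (r, k) = Some u" "F (Suc r, k) = Some v" "u < v" "v < y" by blast
    show "the (F (Suc r, THE k. F (r, k) = Some u)) \<in> ran F \<and>
         value_row F (the (F (Suc r, THE k. F (r, k) = Some u))) = Suc r \<and>
         u < the (F (Suc r, THE k. F (r, k) = Some u)) \<and> the (F (Suc r, THE k. F (r, k) = Some u)) < y"
      unfolding col[OF *(1)] using * ranI value_row_eq[OF sf *(2)] by auto
  next
    fix u v assume a: "u \<in> ran F" "v \<in> ran F" "value_row F u = r" "value_row F v = r" "u < v" "v < y"
    from P[of u] a obtain k u' where *: "F (r, k) = Some u" "F (Suc r, k) = Some u'" by auto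
    from P[of v] a obtain l v' where **: "F (r, l) = Some v" "F (Suc r, l) = Some v'" by auto
    have "k < l" using less[OF **(1) *(1)] a(5) * ** by (cases "k = l") force+
    then have "u' < v'" using less[OF *(2) **(2)] by auto
    then show "the (F (Suc r, THE k. F (r, k) = Some u)) < the (F (Suc r, THE k. F (r, k) = Some v))"
      unfolding col[OF *(1)] col[OF **(1)] using * ** by simp
  next
    fix z assume "z \<in> ran F" "value_row F z = Suc r" "y < z"
    from Q[OF this] obtain k v where *: "F (Suc r, k) = Some z" "F (r, k) = Some v" "y < v" "v < z" by blast
    show "the (F (r, THE k. F (Suc r, k) = Some z)) \<in> ran F \<and>
         value_row F (the (F (r, THE k. F (Suc r, k) = Some z))) = r \<and>
         y < the (F (r, THE k. F (Suc r, k) = Some z)) \<and> the (F (r, THE k. F (Suc r, k) = Some z)) < z"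
      unfolding col[OF *(1)] using * ranI value_row_eq[OF sf *(2)] by auto
  next
    fix u v assume a: "u \<in> ran F" "v \<in> ran F" "value_row F u = Suc r" "value_row F v = Suc r" "y < u" "u < v"
    from Q[of u] a obtain k u' where *: "F (Suc r, k) = Some u" "F (r, k) = Some u'" by auto
    from Q[of v] a obtain l v' where **: "F (Suc r, l) = Some v" "F (r, l) = Some v'" by auto
    have "k < l" using less[OF **(1) *(1)] a(6) * ** by (cases "k = l") force+
    then have "u' < v'" using less[OF *(2) **(2)] by auto
    then show "the (F (r, THE k. F (Suc r, k) = Some u)) < the (F (r, THE k. F (Suc r, k) = Some v))"
      unfolding col[OF *(1)] col[OF **(1)] using * ** by simp
  qed
qed

definition slide_invariant :: "filling \<Rightarrow> filling \<Rightarrow> bool" where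
  "slide_invariant F G \<longleftrightarrow> ran F = ran G \<and>
     (\<forall>n. inc_chain (ran F) (value_row F) n = inc_chain (ran G) (value_row G) n) \<and>
     dec_triple (ran F) (value_row F) = dec_triple (ran G) (value_row G)"

lemma slide_invariant_refl: "slide_invariant F F"
  unfolding slide_invariant_def by simp

lemma slide_invariant_trans: "slide_invariant F G \<Longrightarrow> slide_invariant G H \<Longrightarrow> slide_invariant F H"
  unfolding slide_invariant_def by metis

lemma slide_right_step:
  assumes st: "slide_state M F (r, c)" and x: "F (r, Suc c) = Some x"
    and y: "\<forall>y. F (Suc r, c) = Some y \<longrightarrow> x < y"
  shows "slide_state M (F((r, c) := Some x, (r, Suc c) := None)) (r, Suc c)"
    and "slide_invariant F (F((r, c) := Some x, (r, Suc c) := None))"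
proof -
  have sf: "standard_filling F" using st unfolding slide_state_def by auto
  have "x \<le> v" if "F q = Some v" "cell_le (r, c) q" for q v
    by (rule slide_state_above_hole[OF st that]) (use x y in auto)
  then have min: "\<forall>q v. F q = Some v \<longrightarrow> cell_le (r, c) q \<longrightarrow> x \<le> v" by blast
  have le: "cell_le (r, c) (r, Suc c)" by (simp add: cell_le_def)
  note mv = slide_state_move[OF st x le min]
  show "slide_state M (F((r, c) := Some x, (r, Suc c) := None)) (r, Suc c)" by (rule mv(1))
  have "value_row (F((r, c) := Some x, (r, Suc c) := None)) v = value_row F v" if "v \<in> ran F" for v
    using mv(3)[OF that] value_row_eq[OF sf x] by auto
  then show "slide_invariant F (F((r, c) := Some x, (r, Suc c) := None))"
    unfolding slide_invariant_def mv(2)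
    using inc_chain_cong[of "ran F" _ "value_row F"] dec_triple_cong[of "ran F" _ "value_row F"] by blast
qed

lemma slide_up_step:
  assumes st: "slide_state M F (r, c)" and y: "F (Suc r, c) = Some y"
    and x: "\<forall>x. F (r, Suc c) = Some x \<longrightarrow> y < x"
  shows "slide_state M (F((r, c) := Some y, (Suc r, c) := None)) (Suc r, c)"
    and "slide_invariant F (F((r, c) := Some y, (Suc r, c) := None))"
proof -
  let ?G = "F((r, c) := Some y, (Suc r, c) := None)"
  have sf: "standard_filling F" using st unfolding slide_state_def by auto
  have "y \<le> v" if "F q = Some v" "cell_le (r, c) q" for q v
    by (rule slide_state_above_hole[OF st that]) (use x y in auto)
  then have min: "\<forall>q v. F q = Some v \<longrightarrow> cell_le (r, c) q \<longrightarrow> y \<le> v" by blast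
  have le: "cell_le (r, c) (Suc r, c)" by (simp add: cell_le_def)
  note mv = slide_state_move[OF st y le min]
  show "slide_state M ?G (Suc r, c)" by (rule mv(1))
  have vr: "value_row ?G v = ((value_row F)(y := r)) v" if "v \<in> ran F" for v
    using mv(3)[OF that] by auto
  interpret row_drop "ran F" "value_row F" y r
     "\<lambda>u. the (F (Suc r, THE k. F (r, k) = Some u))" "\<lambda>z. the (F (r, THE k. F (Suc r, k) = Some z))"
    by (rule row_drop_slide_up[OF st y x])
  have "inc_chain (ran F) (value_row F) n = inc_chain (ran F) (value_row ?G) n" for n
  proof -
    have "inc_chain (ran F) (value_row ?G) n = inc_chain (ran F) ((value_row F)(y := r)) n"
      by (rule inc_chain_cong) (rule vr)
    then show ?thesis using inc_chain_drop[of n] inc_chain_undrop[of n] by argo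
  qed
  moreover have "dec_triple (ran F) (value_row F) = dec_triple (ran F) (value_row ?G)"
  proof -
    have "dec_triple (ran F) (value_row ?G) = dec_triple (ran F) ((value_row F)(y := r))"
      by (rule dec_triple_cong) (rule vr)
    then show ?thesis using dec_triple_drop dec_triple_undrop by argo
  qed
  ultimately show "slide_invariant F ?G"
    unfolding slide_invariant_def using mv(2) by auto
qed

section \<open>Complete slides and rectifications\<close>

definition jdt_state :: "(nat \<times> nat) set \<Rightarrow> filling \<Rightarrow> bool" where
  "jdt_state \<mu> F \<longleftrightarrow> standard_filling F \<and> finite \<mu> \<and> lower_set \<mu> \<and> lower_set (\<mu> \<union> dom F) \<and> \<mu> \<inter> dom F = {}"

text \<open>With both neighbours empty the hole is a maximal cell of the shape, so deleting it
  leaves a lower set.\<close>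

lemma slide_state_stop:
  assumes st: "slide_state M F (r, c)" and "F (r, Suc c) = None" "F (Suc r, c) = None" "finite M"
  shows "jdt_state M F"
proof -
  have "lower_set (M \<union> dom F)"
    unfolding lower_set_def
  proof (intro allI impI)
    fix p q assume q: "q \<in> M \<union> dom F" "cell_le p q"
    then have p: "p \<in> M \<union> dom F \<union> {(r, c)}" using st unfolding slide_state_def lower_set_def by blast
    have "p \<noteq> (r, c)"
    proof
      assume p: "p = (r, c)"
      show False
      proof (cases "q \<in> M")
        case True then show ?thesis using st p q unfolding slide_state_def lower_set_def by blast
      next
        case False
        then obtain v where v: "F q = Some v" using q by auto
        show ?thesis using slide_state_above_hole[OF st v] q p assms(2,3) by auto
      qed
    qed
    then show "p \<in> M \<union> dom F" using p by auto
  qed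
  then show ?thesis using assms unfolding slide_state_def jdt_state_def by auto
qed

lemma slide_preserves:
  "slide F h F' \<Longrightarrow> slide_state M F h \<Longrightarrow> finite M \<Longrightarrow> jdt_state M F' \<and> slide_invariant F F'"
proof (induction rule: slide.induct)
  case (stop F r c)
  then show ?case using slide_state_stop slide_invariant_refl by blast
next
  case (right F r c x F')
  then show ?case using slide_right_step[OF right.prems(1) right.hyps(1,2)] slide_invariant_trans by blast
next
  case (up F r c y F')
  then show ?case using slide_up_step[OF up.prems(1) up.hyps(1,2)] slide_invariant_trans by blast
qed

text \<open>Each move increases the distance r + c of the hole from the origin, which
  \<open>B\<close> bounds. Some rule always applies, because distinct cells carry distinct values
  and two filled neighbours compare strictly.\<close>

lemma slide_exists:
  assumes "slide_state M F h" "\<forall>p \<in> dom F \<union> {h}. fst p + snd p \<le> B"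
  shows "\<exists>F'. slide F h F'"
  using assms
proof (induction "B - (fst h + snd h)" arbitrary: F h rule: less_induct)
  case less
  obtain r c where h: "h = (r, c)" by (cases h)
  have st: "slide_state M F (r, c)" using less h by simp
  consider "F (r, Suc c) = None" "F (Suc r, c) = None"
    | x where "F (r, Suc c) = Some x" "\<forall>y. F (Suc r, c) = Some y \<longrightarrow> x < y"
    | y where "F (Suc r, c) = Some y" "\<forall>x. F (r, Suc c) = Some x \<longrightarrow> y < x"
  proof -
    have "x \<noteq> y" if "F (r, Suc c) = Some x" "F (Suc r, c) = Some y" for x y
      using st that unfolding slide_state_def standard_filling_def by (metis n_not_Suc_n prod.inject)
    then show ?thesis
      by (cases "F (r, Suc c)"; cases "F (Suc r, c)") (use that in \<open>auto simp: neq_iff\<close>)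
  qed
  then show ?case
  proof cases
    case 1 then show ?thesis using slide.stop h by blast
  next
    case (2 x)
    have "Suc (r + c) \<le> B" using less.prems(2) 2 by (auto dest!: bspec[of _ _ "(r, Suc c)"])
    then have lt: "B - (fst (r, Suc c) + snd (r, Suc c)) < B - (fst h + snd h)" using h by auto
    have "\<forall>p \<in> dom (F((r, c) := Some x, (r, Suc c) := None)) \<union> {(r, Suc c)}. fst p + snd p \<le> B"
      using less.prems(2) 2 h by force
    from less.hyps[OF lt slide_right_step(1)[OF st 2] this] show ?thesis using slide.right[of F r c x] 2 h by blast
  next
    case (3 y)
    have "Suc (r + c) \<le> B" using less.prems(2) 3 by (auto dest!: bspec[of _ _ "(Suc r, c)"])
    then have lt: "B - (fst (Suc r, c) + snd (Suc r, c)) < B - (fst h + snd h)" using h by auto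
    have "\<forall>p \<in> dom (F((r, c) := Some y, (Suc r, c) := None)) \<union> {(Suc r, c)}. fst p + snd p \<le> B"
      using less.prems(2) 3 h by force
    from less.hyps[OF lt slide_up_step(1)[OF st 3] this] show ?thesis using slide.up[of F r c y] 3 h by blast
  qed
qed

lemma jdt_state_corner:
  assumes st: "jdt_state \<mu> F" and c: "(r, c) \<in> \<mu>" "(r, Suc c) \<notin> \<mu>" "(Suc r, c) \<notin> \<mu>"
  shows "slide_state (\<mu> - {(r, c)}) F (r, c)"
proof -
  have low: "lower_set \<mu>" using st unfolding jdt_state_def by auto
  have "q = (r, c)" if q: "q \<in> \<mu>" "cell_le (r, c) q" for q
  proof (rule ccontr)
    assume "q \<noteq> (r, c)"
    then have "cell_le (r, Suc c) q \<or> cell_le (Suc r, c) q" using q(2) unfolding cell_le_def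
      by (cases q) auto
    then show False using low q c unfolding lower_set_def by blast
  qed
  then have "lower_set (\<mu> - {(r, c)})" using low unfolding lower_set_def by blast
  moreover have "\<mu> - {(r, c)} \<union> dom F \<union> {(r, c)} = \<mu> \<union> dom F" using c by auto
  ultimately show ?thesis using st c unfolding slide_state_def jdt_state_def by auto
qed

text \<open>The corners are arbitrary, so all rectifications of a filling share the two
  statistics.\<close>

lemma jdt_steps_preserve:
  assumes "jdt_step\<^sup>*\<^sup>* (\<mu>, F) (\<mu>', F')" "jdt_state \<mu> F"
  shows "jdt_state \<mu>' F' \<and> slide_invariant F F'"
  using assms
proof (induction "(\<mu>', F')" arbitrary: \<mu>' F' rule: rtranclp_induct)
  case base
  then show ?case using slide_invariant_refl by auto
next
  case (step s)
  obtain \<mu>1 F1 where s: "s = (\<mu>1, F1)" by (cases s)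
  have 1: "jdt_state \<mu>1 F1" "slide_invariant F F1" using step s by auto
  from step(2)[unfolded s] obtain r c where
    a: "(r, c) \<in> \<mu>1" "(r, Suc c) \<notin> \<mu>1" "(Suc r, c) \<notin> \<mu>1" "slide F1 (r, c) F'" "\<mu>' = \<mu>1 - {(r, c)}"
    by (cases rule: jdt_step.cases) auto
  have "finite \<mu>'" using 1(1) a(5) unfolding jdt_state_def by auto
  then show ?case using slide_preserves[OF a(4) jdt_state_corner[OF 1(1) a(1-3)]] a(5) 1(2) slide_invariant_trans
    by blast
qed

lemma rectification_exists:
  assumes "jdt_state \<mu> F"
  shows "\<exists>F'. jdt_step\<^sup>*\<^sup>* (\<mu>, F) ({}, F')"
  using assms
proof (induction "card \<mu>" arbitrary: \<mu> F)
  case 0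
  then have "\<mu> = {}" unfolding jdt_state_def by auto
  then show ?case by blast
next
  case (Suc n)
  then have fin: "finite \<mu>" "\<mu> \<noteq> {}" unfolding jdt_state_def by auto
  define s where "s p = fst p + snd p" for p :: "nat \<times> nat"
  \<comment> \<open>A cell of \<open>\<mu>\<close> with maximal r + c is a corner from which a slide
    may start.\<close>
  have "Max (s ` \<mu>) \<in> s ` \<mu>" using fin by (intro Max_in) auto
  then obtain p where p0: "p \<in> \<mu>" "s p = Max (s ` \<mu>)" by auto
  then have p: "p \<in> \<mu>" "\<forall>q\<in>\<mu>. s q \<le> s p" using fin by auto
  obtain r c where rc: "p = (r, c)" by (cases p)
  have c: "(r, c) \<in> \<mu>" "(r, Suc c) \<notin> \<mu>" "(Suc r, c) \<notin> \<mu>" using p rc unfolding s_def by force+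
  note st = jdt_state_corner[OF Suc.prems c]
  have "finite (dom F \<union> {(r, c)})" using Suc.prems unfolding jdt_state_def standard_filling_def by auto
  then have "finite ((\<lambda>p. fst p + snd p) ` (dom F \<union> {(r, c)}))" by blast
  then obtain B where "\<forall>p \<in> dom F \<union> {(r, c)}. fst p + snd p \<le> B"
    by (meson Max_ge imageI)
  then obtain F1 where F1: "slide F (r, c) F1" using slide_exists[OF st] by blast
  have "finite (\<mu> - {(r, c)})" using fin by auto
  then have j: "jdt_state (\<mu> - {(r, c)}) F1" using slide_preserves[OF F1 st] by auto
  have "n = card (\<mu> - {(r, c)})" using Suc.hyps(2) c(1) fin by simp
  from Suc.hyps(1)[OF this j] obtain F' where F': "jdt_step\<^sup>*\<^sup>* (\<mu> - {(r, c)}, F1) ({}, F')" by blast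
  have "jdt_step (\<mu>, F) (\<mu> - {(r, c)}, F1)" using jdt_step.intros[OF c F1] .
  then show ?case using F' by (meson converse_rtranclp_into_rtranclp)
qed

lemma rectified_shape_iff:
  assumes st: "jdt_state {} F" and card: "card (ran F) = 2 * n"
  shows "{p. F p \<noteq> None} = {(r, c). r < 2 \<and> c < n} \<longleftrightarrow>
    \<not> dec_triple (ran F) (value_row F) \<and> \<not> inc_chain (ran F) (value_row F) (Suc n)"
proof
  have sf: "standard_filling F" and low: "lower_set (dom F)" using st unfolding jdt_state_def by auto
  have inj: "p = q" if "F p = Some v" "F q = Some v" for p q v
    using sf that unfolding standard_filling_def by blast
  have less: "v < w" if "F (p, p') = Some v" "F (q, q') = Some w" "p \<le> q" "p' \<le> q'" "(p, p') \<noteq> (q, q')" for p p' q q' v w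
    using standard_filling_less[OF sf that(1,2)] that(3-) unfolding cell_le_def by simp
  {
    assume sh: "{p. F p \<noteq> None} = {(r, c). r < 2 \<and> c < n}"
    have rc: "r < 2 \<and> c < n" if "F (r, c) = Some v" for r c v using that sh by auto
    have "value_row F v < 2" if v: "v \<in> ran F" for v
    proof -
      obtain r c where "F (r, c) = Some v" using v unfolding ran_def by auto
      then show ?thesis using rc value_row_eq[OF sf] by blast
    qed
    then have 1: "\<not> dec_triple (ran F) (value_row F)" unfolding dec_triple_def by fastforce
    have "\<not> inc_chain (ran F) (value_row F) (Suc n)"
    proof
      assume "inc_chain (ran F) (value_row F) (Suc n)"
      then obtain S where S: "S \<subseteq> ran F" "card S = Suc n"
        "\<And>x y. x \<in> S \<Longrightarrow> y \<in> S \<Longrightarrow> x < y \<Longrightarrow> value_row F y \<le> value_row F x"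
        unfolding inc_chain_def by blast
      \<comment> \<open>An increasing chain meets every column at most once: columns increase
        upwards, while along the chain the rows weakly descend. So it has at most \<open>n\<close>
        elements.\<close>
      define col where "col v = (SOME c. \<exists>r. F (r, c) = Some v)" for v
      have col: "F (value_row F v, col v) = Some v" if "v \<in> S" for v
      proof -
        have "\<exists>c r. F (r, c) = Some v" using that S(1) unfolding ran_def by fastforce
        then have "\<exists>r. F (r, col v) = Some v" unfolding col_def by (rule someI_ex)
        then show ?thesis using value_row_eq[OF sf] by blast
      qed
      have "x = y" if xy: "x \<in> S" "y \<in> S" "col x = col y" for x y
      proof (rule ccontr)
        assume "x \<noteq> y"
        have *: False if "x \<in> S" "y \<in> S" "col x = col y" "x < y" for x y
        proof (cases "value_row F x = value_row F y")
          case True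
          then show ?thesis using col[OF that(1)] col[OF that(2)] that by simp
        next
          case False
          then show ?thesis using less[OF col[OF that(2)] col[OF that(1)]] S(3)[OF that(1,2,4)] that by simp
        qed
        show False using *[of x y] *[of y x] xy \<open>x \<noteq> y\<close> by force
      qed
      then have "inj_on col S" by (auto intro: inj_onI)
      moreover have "col ` S \<subseteq> {..<n}" using rc col by auto
      ultimately have "card S \<le> n" using card_inj_on_le[of col S "{..<n}"] by auto
      then show False using S(2) by auto
    qed
    with 1 show "\<not> dec_triple (ran F) (value_row F) \<and> \<not> inc_chain (ran F) (value_row F) (Suc n)" by blast
  next
    assume as: "\<not> dec_triple (ran F) (value_row F) \<and> \<not> inc_chain (ran F) (value_row F) (Suc n)"
    have lowD: "\<exists>v. F (r', c') = Some v" if "F (r, c) = Some w" "r' \<le> r" "c' \<le> c" for r c r' c' w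
      using low that unfolding lower_set_def cell_le_def by force
    have sub: "r < 2 \<and> c < n" if F: "F (r, c) = Some v" for r c v
    proof (rule ccontr)
      assume "\<not> (r < 2 \<and> c < n)"
      then consider "2 \<le> r" | "n \<le> c" by linarith
      then show False
      proof cases
        case 1
        obtain x where x: "F (0, c) = Some x" using lowD[OF F, of 0 c] by auto
        obtain y where y: "F (1, c) = Some y" using lowD[OF F, of 1 c] 1 by auto
        obtain z where z: "F (2, c) = Some z" using lowD[OF F, of 2 c] 1 by auto
        have "dec_triple (ran F) (value_row F)" unfolding dec_triple_def
          using ranI[of F, OF x] ranI[of F, OF y] ranI[of F, OF z] less[OF x y] less[OF y z]
            value_row_eq[OF sf x] value_row_eq[OF sf y] value_row_eq[OF sf z]
          by (intro bexI[of _ x] bexI[of _ y] bexI[of _ z]) simp_all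
        then show False using as by blast
      next
        case 2
        define f where "f k = the (F (0, k))" for k
        have f: "F (0, k) = Some (f k)" if "k \<le> n" for k using lowD[OF F, of 0 k] 2 that f_def by auto
        have "inj_on f {..n}" using f inj by (intro inj_onI) (metis atMost_iff prod.inject)
        then have "card (f ` {..n}) = Suc n" using card_image by fastforce
        moreover have "f ` {..n} \<subseteq> ran F" using f ranI by fastforce
        moreover have "value_row F x = 0" if "x \<in> f ` {..n}" for x
          using that f value_row_eq[OF sf] by auto
        ultimately have "inc_chain (ran F) (value_row F) (Suc n)" unfolding inc_chain_def
          by (intro exI[of _ "f ` {..n}"]) auto
        then show False using as by blast
      qed
    qed
    \<comment> \<open>The 2n cells fit into the rectangle and hence fill it.\<close>
    have "dom F \<subseteq> {..<2} \<times> {..<n}" using sub by auto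
    moreover have "card (dom F) = card ({..<2::nat} \<times> {..<n})"
    proof -
      have "inj_on (\<lambda>p. the (F p)) (dom F)" using inj by (intro inj_onI) auto
      moreover have "(\<lambda>p. the (F p)) ` dom F = ran F" unfolding ran_def by force
      ultimately show ?thesis using card card_image by fastforce
    qed
    ultimately have "dom F = {..<2} \<times> {..<n}" by (intro card_subset_eq) auto
    then show "{p. F p \<noteq> None} = {(r, c). r < 2 \<and> c < n}" by (auto simp: dom_def)
  }
qed

subsection \<open>Standard tableaux and their reading words\<close>

lemma cell_eq_Some:
  "cell T (r, c) = Some v \<longleftrightarrow> r < length T \<and> c < length (T ! r) \<and> T ! r ! c = v"
  unfolding cell_def by auto

lemma SYT_length_concat:
  assumes "is_SYT lam T" shows "length (concat T) = sum_list lam"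
  using assms unfolding is_SYT_def by (auto simp: length_concat)

lemma SYT_row_length_mono:
  assumes "is_SYT lam T" "r \<le> r'" "r' < length T"
  shows "length (T ! r') \<le> length (T ! r)"
proof -
  have "sorted_wrt (\<ge>) (map length T)" using assms(1) unfolding is_SYT_def is_partition_def by auto
  then show ?thesis using assms(2,3) sorted_wrt_nth_less[of "(\<ge>)" "map length T" r r']
    by (cases "r = r'") auto
qed

lemma SYT_column_less:
  assumes "is_SYT lam T" "r < r'" "r' < length T" "c < length (T ! r')"
  shows "T ! r ! c < T ! r' ! c"
  using assms(2-)
proof (induction r')
  case (Suc r')
  have step: "T ! r' ! c < T ! Suc r' ! c" using assms(1) Suc.prems unfolding is_SYT_def by blast
  show ?case
  proof (cases "r = r'")
    case True then show ?thesis using step by simp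
  next
    case False
    have "c < length (T ! r')" using SYT_row_length_mono[OF assms(1), of r' "Suc r'"] Suc.prems by simp
    then have "T ! r ! c < T ! r' ! c" using Suc False by simp
    then show ?thesis using step by simp
  qed
qed simp

lemma SYT_cell_less:
  assumes syt: "is_SYT lam T" and "cell T p = Some x" "cell T q = Some y" "cell_le p q" "p \<noteq> q"
  shows "x < y"
proof -
  obtain r c r' c' where pq: "p = (r, c)" "q = (r', c')" by (metis surj_pair)
  have a: "r < length T" "c < length (T ! r)" "T ! r ! c = x" "r' < length T" "c' < length (T ! r')"
    "T ! r' ! c' = y" "r \<le> r'" "c \<le> c'" "r \<noteq> r' \<or> c \<noteq> c'"
    using assms(2-) unfolding pq cell_eq_Some cell_le_def by auto
  have row: "sorted_wrt (<) (T ! r)" using syt a(1) unfolding is_SYT_def by auto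
  have c': "c' < length (T ! r)" using SYT_row_length_mono[OF syt a(7,4)] a by simp
  have 1: "T ! r ! c \<le> T ! r ! c'" using sorted_wrt_nth_less[OF row _ c', of c] a by (cases "c = c'") auto
  have 3: "T ! r ! c < T ! r ! c'" if "c \<noteq> c'" using sorted_wrt_nth_less[OF row _ c', of c] a that by auto
  have 2: "T ! r ! c' < T ! r' ! c'" if "r \<noteq> r'" using SYT_column_less[OF syt, of r r' c'] a that by auto
  show ?thesis using 1 3 2 a by (cases "r = r'") auto
qed

lemma SYT_cell_lower:
  assumes syt: "is_SYT lam T" and "cell T q = Some y" "cell_le p q"
  shows "\<exists>x. cell T p = Some x"
proof -
  obtain r c r' c' where pq: "p = (r, c)" "q = (r', c')" by (metis surj_pair)
  have "r' < length T" "c' < length (T ! r')" "r \<le> r'" "c \<le> c'"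
    using assms(2-) unfolding pq cell_eq_Some cell_le_def by auto
  then show ?thesis unfolding pq cell_eq_Some using SYT_row_length_mono[OF syt, of r r'] by auto
qed

lemma SYT_rows_disjoint:
  assumes "is_SYT lam T" "r < length T" "r' < length T" "r \<noteq> r'"
  shows "set (T ! r) \<inter> set (T ! r') = {}"
proof -
  \<comment> \<open>\<open>distinct_concat_iff\<close> speaks of \<open>removeAll [] T\<close>;
    partition parts are positive, so no row is removed.\<close>
  have "\<forall>R\<in>set T. R \<noteq> []" using assms(1) unfolding is_SYT_def is_partition_def by fastforce
  then have rm: "removeAll [] T = T" by (metis removeAll_id)
  have d: "distinct (concat T)" using assms(1) unfolding is_SYT_def by blast
  then have "distinct T" using rm unfolding distinct_concat_iff by simp
  then have "T ! r \<noteq> T ! r'" using assms nth_eq_iff_index_eq by blast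
  then show ?thesis using d assms(2,3) unfolding distinct_concat_iff by (meson nth_mem)
qed

lemma SYT_row_of:
  assumes "is_SYT lam T" "r < length T" "v \<in> set (T ! r)"
  shows "row_of T v = r"
  unfolding row_of_def using assms SYT_rows_disjoint[OF assms(1)]
  by (intro the_equality) blast+

lemma SYT_cell_inj:
  assumes syt: "is_SYT lam T" and "cell T p = Some v" "cell T q = Some v"
  shows "p = q"
proof -
  obtain r c r' c' where pq: "p = (r, c)" "q = (r', c')" by (metis surj_pair)
  have a: "r < length T" "c < length (T ! r)" "T ! r ! c = v" "r' < length T" "c' < length (T ! r')"
    "T ! r' ! c' = v"
    using assms(2-) unfolding pq cell_eq_Some by auto
  have r: "r = r'" using SYT_row_of[OF syt, of r v] SYT_row_of[OF syt, of r' v] a nth_mem by metis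
  have "distinct (T ! r)" using syt a(1) unfolding is_SYT_def distinct_concat_iff by simp
  then have "c = c'" using a r nth_eq_iff_index_eq by metis
  then show ?thesis using pq r by simp
qed

lemma SYT_cell_exists:
  assumes "is_SYT lam T"
  shows "v \<in> {1..sum_list lam} \<longleftrightarrow> (\<exists>p. cell T p = Some v)"
proof -
  have "v \<in> {1..sum_list lam} \<longleftrightarrow> v \<in> set (concat T)" using assms unfolding is_SYT_def by blast
  also have "\<dots> \<longleftrightarrow> (\<exists>r c. r < length T \<and> c < length (T ! r) \<and> T ! r ! c = v)"
    unfolding set_concat UN_iff by (metis in_set_conv_nth)
  finally show ?thesis using cell_eq_Some by auto
qed

lemma SYT_cells_finite:
  assumes "is_SYT lam T" shows "finite {p. \<exists>v. cell T p = Some v}"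
proof (rule inj_on_finite)
  show "inj_on (\<lambda>p. the (cell T p)) {p. \<exists>v. cell T p = Some v}"
    using SYT_cell_inj[OF assms] by (intro inj_onI) auto
  show "(\<lambda>p. the (cell T p)) ` {p. \<exists>v. cell T p = Some v} \<subseteq> {1..sum_list lam}"
  proof (rule image_subsetI)
    fix p assume "p \<in> {p. \<exists>v. cell T p = Some v}"
    then obtain v where v: "cell T p = Some v" by blast
    then have "v \<in> {1..sum_list lam}" using SYT_cell_exists[OF assms] by blast
    then show "the (cell T p) \<in> {1..sum_list lam}" using v by simp
  qed
qed simp

text \<open>Rectifications exist and all have the statistics of the initial skew filling, so the
  existential over rectifications in \<open>has_rect\<close> collapses to a condition on
  \<open>T\<close>.\<close>

lemma has_rect_iff:
  assumes syt: "is_SYT lam T"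
  shows "has_rect T a b \<longleftrightarrow> 1 \<le> a \<and> a \<le> b \<and> b \<le> sum_list lam \<and> even (b + 1 - a) \<and>
    \<not> dec_triple {a..b} (row_of T) \<and> \<not> inc_chain {a..b} (row_of T) (Suc ((b + 1 - a) div 2))"
proof (cases "1 \<le> a \<and> a \<le> b \<and> b \<le> sum_list lam \<and> even (b + 1 - a)")
  case False
  then show ?thesis unfolding has_rect_def SYT_length_concat[OF syt] by auto
next
  case True
  define F0 :: filling where "F0 = (\<lambda>p. case cell T p of Some v \<Rightarrow> if a \<le> v \<and> v \<le> b then Some v else None
                                 | None \<Rightarrow> None)"
  define \<mu>0 where "\<mu>0 = {p. \<exists>v. cell T p = Some v \<and> v < a}"
  have F0: "F0 p = Some v \<longleftrightarrow> cell T p = Some v \<and> a \<le> v \<and> v \<le> b" for p v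
    unfolding F0_def by (cases "cell T p") auto
  have "dom F0 \<subseteq> {p. \<exists>v. cell T p = Some v}" unfolding F0_def dom_def
    by (simp add: Collect_mono_iff split: option.splits)
  moreover have "\<mu>0 \<subseteq> {p. \<exists>v. cell T p = Some v}" unfolding \<mu>0_def by blast
  ultimately have fin: "finite (dom F0)" "finite \<mu>0"
    using finite_subset[OF _ SYT_cells_finite[OF syt]] by blast+
  have sf: "standard_filling F0"
    unfolding standard_filling_def F0 using fin(1) SYT_cell_inj[OF syt] SYT_cell_less[OF syt] by blast
  have less: "x \<le> y" if "cell T p = Some x" "cell T q = Some y" "cell_le p q" for p q x y
    using SYT_cell_less[OF syt that] that(1,2) by (cases "p = q") auto
  \<comment> \<open>Sublevel sets of a tableau are lower sets: level \<open>a\<close> gives the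
    inner shape, level \<open>Suc b\<close> the whole shape.\<close>
  have low: "lower_set {p. \<exists>v. cell T p = Some v \<and> v < k}" for k
    unfolding lower_set_def mem_Collect_eq using SYT_cell_lower[OF syt] less by (meson le_less_trans)
  have un: "\<mu>0 \<union> dom F0 = {p. \<exists>v. cell T p = Some v \<and> v < Suc b}"
  proof -
    have "(\<exists>v. cell T p = Some v \<and> v < a) \<or> F0 p \<noteq> None \<longleftrightarrow> (\<exists>v. cell T p = Some v \<and> v < Suc b)" for p
      unfolding F0_def using True by (cases "cell T p") auto
    then show ?thesis unfolding \<mu>0_def dom_def by blast
  qed
  have st: "jdt_state \<mu>0 F0" unfolding jdt_state_def un
    using sf fin low[of a] low[of "Suc b"] F0 unfolding \<mu>0_def dom_def by fastforce
  have ran: "ran F0 = {a..b}"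
  proof -
    have "v \<in> {1..sum_list lam}" if "a \<le> v \<and> v \<le> b" for v using that True by simp
    then show ?thesis unfolding ran_def F0 using SYT_cell_exists[OF syt] by fastforce
  qed
  have vr: "value_row F0 v = row_of T v" if "v \<in> {a..b}" for v
  proof -
    have "v \<in> ran F0" using that ran by simp
    then obtain r c where rc: "F0 (r, c) = Some v" unfolding ran_def by auto
    then have "r < length T" "v \<in> set (T ! r)" using F0 cell_eq_Some by auto
    then show ?thesis using value_row_eq[OF sf rc] SYT_row_of[OF syt] by simp
  qed
  define n where "n = (b + 1 - a) div 2"
  have shape: "{p. F' p \<noteq> None} = {(r, c). r < 2 \<and> c < n} \<longleftrightarrow>
     \<not> dec_triple {a..b} (row_of T) \<and> \<not> inc_chain {a..b} (row_of T) (Suc n)"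
    if "jdt_step\<^sup>*\<^sup>* (\<mu>0, F0) ({}, F')" for F'
  proof -
    note p = jdt_steps_preserve[OF that st]
    have "ran F' = {a..b}" using p ran unfolding slide_invariant_def by auto
    then have "card (ran F') = 2 * n" using True unfolding n_def by auto
    then have "{p. F' p \<noteq> None} = {(r, c). r < 2 \<and> c < n} \<longleftrightarrow>
      \<not> dec_triple (ran F0) (value_row F0) \<and> \<not> inc_chain (ran F0) (value_row F0) (Suc n)"
      using rectified_shape_iff[of F' n] p unfolding slide_invariant_def by metis
    then show ?thesis unfolding ran using inc_chain_cong[of "{a..b}", OF vr] dec_triple_cong[of "{a..b}", OF vr] by simp
  qed
  obtain F' where "jdt_step\<^sup>*\<^sup>* (\<mu>0, F0) ({}, F')" using rectification_exists[OF st] by blast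
  then have "(\<exists>F'. jdt_step\<^sup>*\<^sup>* (\<mu>0, F0) ({}, F') \<and> {p. F' p \<noteq> None} = {(r, c). r < 2 \<and> c < n}) \<longleftrightarrow>
     \<not> dec_triple {a..b} (row_of T) \<and> \<not> inc_chain {a..b} (row_of T) (Suc n)"
    using shape by metis
  then show ?thesis unfolding has_rect_def SYT_length_concat[OF syt] Let_def
    F0_def[symmetric] \<mu>0_def[symmetric] n_def[symmetric] using True by blast
qed

definition wpos :: "'a list \<Rightarrow> 'a \<Rightarrow> nat" where
  "wpos w v = (THE t. t < length w \<and> w ! t = v)"

lemma wpos_nth: "distinct w \<Longrightarrow> t < length w \<Longrightarrow> wpos w (w ! t) = t"
  unfolding wpos_def by (rule the_equality) (auto simp: nth_eq_iff_index_eq)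

lemma wpos_less: "distinct w \<Longrightarrow> v \<in> set w \<Longrightarrow> wpos w v < length w"
  by (metis in_set_conv_nth wpos_nth)

lemma nth_wpos: "distinct w \<Longrightarrow> v \<in> set w \<Longrightarrow> w ! wpos w v = v"
  by (metis in_set_conv_nth wpos_nth)

lemma wpos_inj: "distinct w \<Longrightarrow> u \<in> set w \<Longrightarrow> v \<in> set w \<Longrightarrow> wpos w u = wpos w v \<longleftrightarrow> u = v"
  by (metis nth_wpos)

lemma sorted_wrt_concat:
  "(\<forall>xs\<in>set xss. sorted_wrt P xs) \<Longrightarrow> sorted_wrt (\<lambda>xs ys. \<forall>x\<in>set xs. \<forall>y\<in>set ys. P x y) xss
    \<Longrightarrow> sorted_wrt P (concat xss)"
  by (induction xss) (auto simp: sorted_wrt_append)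

lemma SYT_rowword_sorted:
  assumes syt: "is_SYT lam T"
  shows "sorted_wrt (\<lambda>x y. row_of T y \<le> row_of T x \<and> (row_of T x = row_of T y \<longrightarrow> x < y)) (rowword T)"
  unfolding rowword_def
proof (rule sorted_wrt_concat)
  let ?P = "\<lambda>x y. row_of T y \<le> row_of T x \<and> (row_of T x = row_of T y \<longrightarrow> x < y)"
  show "\<forall>xs\<in>set (rev T). sorted_wrt ?P xs"
  proof
    fix R assume "R \<in> set (rev T)"
    then obtain r where r: "r < length T" "R = T ! r" by (metis in_set_conv_nth set_rev)
    have "sorted_wrt (<) R" using syt r unfolding is_SYT_def by auto
    then show "sorted_wrt ?P R"
      by (rule sorted_wrt_mono_rel[rotated]) (use SYT_row_of[OF syt r(1)] r in auto)
  qed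
  show "sorted_wrt (\<lambda>xs ys. \<forall>x\<in>set xs. \<forall>y\<in>set ys. ?P x y) (rev T)"
    unfolding sorted_wrt_rev
  proof (unfold sorted_wrt_iff_nth_less, intro allI impI ballI)
    fix a b y x assume "a < b" "b < length T" "x \<in> set (T ! b)" "y \<in> set (T ! a)"
    then show "?P x y" using SYT_row_of[OF syt, of b x] SYT_row_of[OF syt, of a y] by simp
  qed
qed

lemma SYT_rowword:
  assumes "is_SYT lam T"
  shows "distinct (rowword T)" "set (rowword T) = {1..sum_list lam}" "length (rowword T) = sum_list lam"
proof -
  have d: "distinct (concat T)" and s: "set (concat T) = {1..sum_list lam}"
    using assms unfolding is_SYT_def by auto
  have "length (concat (rev T)) = length (concat T)" by (simp add: length_concat rev_map[symmetric])
  then have "distinct (concat (rev T))"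
    using distinct_card[OF d] by (intro card_distinct) simp
  then show "distinct (rowword T)" unfolding rowword_def .
  show st: "set (rowword T) = {1..sum_list lam}" using s unfolding rowword_def by simp
  show "length (rowword T) = sum_list lam"
    using st \<open>distinct (rowword T)\<close> distinct_card by fastforce
qed

text \<open>Rows are read from the top and each row increases, so for \<open>x < y\<close> a tie of
  rows also puts \<open>x\<close> first. This is the passage from rows, which slides control, to
  reading positions, which bracketing controls.\<close>

lemma SYT_row_le_iff:
  assumes syt: "is_SYT lam T" and xy: "x \<in> {1..sum_list lam}" "y \<in> {1..sum_list lam}" "x < y"
  shows "row_of T y \<le> row_of T x \<longleftrightarrow> wpos (rowword T) x < wpos (rowword T) y"
proof -
  note w = SYT_rowword[OF syt]
  let ?p = "wpos (rowword T)"
  have ne: "?p x \<noteq> ?p y" using wpos_inj[OF w(1)] xy unfolding w(2)[symmetric] by auto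
  have *: "row_of T v \<le> row_of T u \<and> (row_of T u = row_of T v \<longrightarrow> u < v)"
    if "?p u < ?p v" "u \<in> {1..sum_list lam}" "v \<in> {1..sum_list lam}" for u v
    using sorted_wrt_nth_less[OF SYT_rowword_sorted[OF syt] that(1)] wpos_less[OF w(1), of v]
      nth_wpos[OF w(1), of u] nth_wpos[OF w(1), of v] that(2,3) unfolding w(2) by simp
  show ?thesis using *[of x y] *[of y x] ne xy by fastforce
qed

lemma SYT_descents:
  assumes syt: "is_SYT lam T"
  shows "descents T = {d. 1 \<le> d \<and> d < sum_list lam \<and> wpos (rowword T) (Suc d) < wpos (rowword T) d}"
proof -
  note w = SYT_rowword[OF syt]
  have "row_of T d < row_of T (Suc d) \<longleftrightarrow> wpos (rowword T) (Suc d) < wpos (rowword T) d"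
    if "1 \<le> d" "d < sum_list lam" for d
    using SYT_row_le_iff[OF syt, of d "Suc d"] wpos_inj[OF w(1), of d "Suc d"] that unfolding w(2) by force
  then show ?thesis unfolding descents_def SYT_length_concat[OF syt] by auto
qed

subsection \<open>Words whose insertion tableau is a Dyck pattern\<close>

lemma row_ins_cases:
  assumes "sorted R"
  obtains (append) "row_ins x R = (R @ [x], None)" "\<forall>y\<in>set R. y \<le> x"
  | (bump) k where "k < length R" "row_ins x R = (R[k := x], Some (R ! k))" "x < R ! k" "\<forall>j<k. R ! j \<le> x"
proof (cases "length (takeWhile (\<lambda>y. y \<le> x) R) = length R")
  case True
  then have "takeWhile (\<lambda>y. y \<le> x) R = R" by (metis takeWhile_eq_take take_all order_refl)
  then have "\<forall>y\<in>set R. y \<le> x" by (metis set_takeWhileD)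
  then show ?thesis using that(1) True unfolding row_ins_def by simp
next
  case False
  let ?k = "length (takeWhile (\<lambda>y. y \<le> x) R)"
  have k: "?k < length R" using False length_takeWhile_le[of "\<lambda>y. y \<le> x" R] by linarith
  have "x < R ! ?k" using nth_length_takeWhile[OF k] by simp
  moreover have "\<forall>j<?k. R ! j \<le> x" using takeWhile_nth nth_mem set_takeWhileD by metis
  ultimately show ?thesis using that(2)[OF k] False unfolding row_ins_def Let_def by simp
qed

text \<open>What running an insertion backwards requires: sortedness locates the bump, and an empty
  row would be a second preimage of a row with one cell.\<close>

definition rows_ok :: "tableau \<Rightarrow> bool" where
  "rows_ok P \<longleftrightarrow> (\<forall>R\<in>set P. R \<noteq> [] \<and> sorted R)"

lemma rsk_ins_rows_ok: "rows_ok P \<Longrightarrow> rows_ok (rsk_ins x P)"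
proof (induction x P rule: rsk_ins.induct)
  case (1 x)
  then show ?case by (simp add: rows_ok_def)
next
  case (2 x R Rs)
  have R: "R \<noteq> []" "sorted R" and Rs: "rows_ok Rs" using 2(2) unfolding rows_ok_def by auto
  show ?case
  proof (cases rule: row_ins_cases[OF R(2), of x])
    case 1
    then show ?thesis using 2(2) unfolding rows_ok_def by (simp add: sorted_append)
  next
    case (2 k)
    have "sorted (R[k := x])"
      unfolding sorted_iff_nth_mono_less
    proof (intro allI impI)
      fix a b assume ab: "a < b" "b < length (R[k := x])"
      have "R ! a \<le> R ! b" "a < k \<or> k \<le> a" "k \<le> b \<Longrightarrow> R ! k \<le> R ! b"
        using ab sorted_nth_mono[OF R(2)] by auto
      then show "R[k := x] ! a \<le> R[k := x] ! b" using ab 2 by (auto simp: nth_list_update)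
    qed
    moreover have "rows_ok (rsk_ins (R ! k) Rs)" using "2.IH" 2(2) Rs by simp
    ultimately show ?thesis using 2(2) R(1) by (auto simp: rows_ok_def)
  qed
qed

lemma rsk_P_snoc: "rsk_P (w @ [x]) = rsk_ins x (rsk_P w)"
  unfolding rsk_P_def by simp

lemma rsk_P_rows_ok: "rows_ok (rsk_P w)"
  by (induction w rule: rev_induct) (auto simp: rsk_P_snoc rsk_ins_rows_ok, simp add: rsk_P_def rows_ok_def)

lemma rsk_ins_nonempty: "rsk_ins x P \<noteq> []"
  by (cases P) (auto split: prod.split option.split)

text \<open>The insertion tableau after reading \<open>p\<close> of the $a$'s and \<open>s\<close> of the $b$'s, of which \<open>q\<close> have been
bumped; the unbracketed $b$'s are those still in the bottom row.\<close>

definition dyck_tab :: "nat \<Rightarrow> nat \<Rightarrow> nat \<Rightarrow> nat \<Rightarrow> nat \<Rightarrow> tableau" where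
  "dyck_tab i m p q s = (let bot = [i..<i+p] @ [i+m+1+q..<i+m+1+s] in
     if q = 0 then (if bot = [] then [] else [bot]) else [bot, [i+m+1..<i+m+1+q]])"

text \<open>Reverse insertion stays in the family: \<open>B\<close> appends the next b to the bottom
  row, \<open>free\<close> appends an a when no b is left there to bump, and in \<open>bump\<close>
  an a sends the leftmost remaining b to the top row.\<close>

lemma rsk_ins_dyck_tab:
  assumes eq: "rsk_ins x P = dyck_tab i m p q s" and ok: "rows_ok P" and b: "q \<le> s" "p \<le> Suc m"
  obtains (B) "q < s" "x = i+m+s" "P = dyck_tab i m p q (s - 1)"
  | (free) "q = s" "0 < p" "x = i+p-1" "P = dyck_tab i m (p - 1) q s"
  | (bump) "0 < q" "0 < p" "x = i+p-1" "P = dyck_tab i m (p - 1) (q - 1) s"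
proof -
  let ?bot = "[i..<i+p] @ [i+m+1+q..<i+m+1+s]"
  note goals = that
  have appended: thesis if Rx: "R @ [x] = ?bot" and P: "P = (if R = [] \<and> q = 0 then [] else R # (if q = 0 then [] else [[i+m+1..<i+m+1+q]]))" for R
  proof (cases "q < s")
    case True
    then have "[i+m+1+q..<i+m+1+s] = [i+m+1+q..<i+m+s] @ [i+m+s]"
      using upt_Suc_append[of "i+m+1+q" "i+m+s"] by simp
    then have "R @ [x] = ([i..<i+p] @ [i+m+1+q..<i+m+s]) @ [i+m+s]" using Rx by simp
    then have x: "x = i+m+s" and R: "R = [i..<i+p] @ [i+m+1+q..<i+m+s]" by blast+
    have "P = dyck_tab i m p q (s - 1)" unfolding P R dyck_tab_def Let_def using True by simp
    then show thesis using goals(1) True x by blast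
  next
    case False
    then have qs: "q = s" using b by simp
    then have p: "0 < p" using Rx by (cases p) auto
    then have "[i..<i+p] = [i..<i+(p-1)] @ [i+p-1]" using upt_Suc_append[of i "i+(p-1)"] by simp
    then have x: "x = i+p-1" and R: "R = [i..<i+(p-1)]" using Rx qs by auto
    have "P = dyck_tab i m (p - 1) q s" unfolding P R dyck_tab_def Let_def using qs by simp
    then show thesis using goals(2) qs p x by blast
  qed
  show thesis
  proof (cases P)
    case Nil
    then have "[[x]] = dyck_tab i m p q s" using eq by simp
    then have "q = 0" "[x] = ?bot" unfolding dyck_tab_def Let_def by (auto split: if_splits)
    then show thesis using appended[of "[]"] Nil by simp
  next
    case (Cons R Rs)
    have R: "R \<noteq> []" "sorted R" and Rs: "rows_ok Rs" using ok Cons unfolding rows_ok_def by auto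
    show thesis
    proof (cases rule: row_ins_cases[OF R(2), of x])
      case 1
      then have "(R @ [x]) # Rs = dyck_tab i m p q s" using eq Cons by simp
      then have "R @ [x] = ?bot" "Rs = (if q = 0 then [] else [[i+m+1..<i+m+1+q]])"
        unfolding dyck_tab_def Let_def by (auto split: if_splits)
      then show thesis using appended[of R] Cons R(1) by simp
    next
      case (2 k)
      let ?y = "R ! k"
      have e: "R[k := x] # rsk_ins ?y Rs = dyck_tab i m p q s" using eq Cons 2 by simp
      then have q: "0 < q" and bot: "R[k := x] = ?bot" and top: "rsk_ins ?y Rs = [[i+m+1..<i+m+1+q]]"
        using rsk_ins_nonempty[of ?y Rs] unfolding dyck_tab_def Let_def by (auto split: if_splits)
      have tq: "[i+m+1..<i+m+1+q] = [i+m+1..<i+m+q] @ [i+m+q]"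
        using upt_Suc_append[of "i+m+1" "i+m+q"] q by simp
      \<comment> \<open>The bumped letter must be appended to the top row: bumping again would
        create a third row.\<close>
      have y: "?y = i+m+q \<and> Rs = (if q = 1 then [] else [[i+m+1..<i+m+q]])"
      proof (cases Rs)
        case Nil
        then have *: "[?y] = [i+m+1..<i+m+1+q]" using top by simp
        then have "length [i+m+1..<i+m+1+q] = 1" by (metis length_Cons list.size(3) One_nat_def)
        then have "i+m+1+q - (i+m+1) = 1" by (simp only: length_upt)
        then have "q = 1" by simp
        then show ?thesis using * Nil by simp
      next
        case (Cons R2 Rs2)
        have R2: "R2 \<noteq> []" "sorted R2" using Rs Cons unfolding rows_ok_def by auto
        show ?thesis
        proof (cases rule: row_ins_cases[OF R2(2), of ?y])
          case 1
          then have "R2 @ [?y] = [i+m+1..<i+m+q] @ [i+m+q]" "Rs2 = []" using top Cons tq by auto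
          moreover from this have "q \<noteq> 1" using R2(1) by auto
          ultimately show ?thesis using Cons by auto
        next
          case (2 l)
          then show ?thesis using top Cons rsk_ins_nonempty[of "R2 ! l" Rs2] by simp
        qed
      qed
      have lenR: "length R = length ?bot" using bot by (metis length_list_update)
      then have k: "k < length ?bot" using 2(1) by simp
      have x: "x = ?bot ! k" using bot 2(1) by (metis nth_list_update_eq)
      \<comment> \<open>The slot of \<open>x\<close> lies among the a's: the later entries of the
        new bottom row exceed the bumped letter i+m+q, while \<open>x\<close> is smaller.\<close>
      have kp: "k < p"
      proof (rule ccontr)
        assume "\<not> k < p"
        then have "?bot ! k = i+m+1+q+(k-p)" using k by (simp add: nth_append del: upt_Suc)
        then show False using x 2(3) y by simp
      qed
      \<comment> \<open>Otherwise i+m+q would stand in the sorted row \<open>R\<close> to the left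
        of a letter that is at most i+m.\<close>
      have "k = p - 1"
      proof (rule ccontr)
        assume n: "k \<noteq> p - 1"
        then have "R ! (p - 1) = R[k := x] ! (p - 1)" by simp
        also have "\<dots> = i + (p - 1)" unfolding bot using kp by (simp add: nth_append)
        finally have "R ! (p - 1) \<le> i + m" using b kp by simp
        moreover have "R ! k \<le> R ! (p - 1)" using sorted_nth_mono[OF R(2), of k "p - 1"] kp lenR by simp
        ultimately show False using y q by simp
      qed
      then have k1: "k = p - 1" and p0: "0 < p" using kp by auto
      have R': "R = ?bot[k := i+m+q]" using bot y by (metis list_update_id list_update_overwrite)
      have "[i..<i+p] = [i..<i+(p-1)] @ [i+p-1]" using upt_Suc_append[of i "i+(p-1)"] p0 by simp
      moreover have "[i+m+q..<i+m+1+s] = (i+m+q) # [i+m+1+q..<i+m+1+s]" using b(1) by (simp add: upt_conv_Cons)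
      ultimately have Rf: "R = [i..<i+(p-1)] @ [i+m+1+(q-1)..<i+m+1+s]" using R' k1 q by (simp add: list_update_append)
      have "P = dyck_tab i m (p - 1) (q - 1) s"
        unfolding dyck_tab_def Let_def Rf[symmetric] Cons using R(1) y q by auto
      moreover have "x = i+p-1" using x k1 p0 by (simp add: nth_append)
      ultimately show thesis using goals(3) q p0 by blast
    qed
  qed
qed

text \<open>The counter \<open>c\<close> of \<open>unbr\<close> after the word \<open>w\<close>:
  letters \<open>Suc i\<close> still waiting for a bracket. The truncated \<open>c - 1\<close>
  leaves it at 0 when an \<open>i\<close> is unbracketed.\<close>

definition open_count :: "nat \<Rightarrow> nat \<Rightarrow> nat list \<Rightarrow> nat" where
  "open_count i c w = foldl (\<lambda>c x. if x = Suc i then Suc c else if x = i then c - 1 else c) c w"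

lemma open_count_snoc [simp]:
  "open_count i c (w @ [x]) =
    (if x = Suc i then Suc (open_count i c w) else if x = i then open_count i c w - 1 else open_count i c w)"
  unfolding open_count_def by simp

text \<open>Adapts the left recursion of \<open>unbr\<close> to an induction that appends letters,
  as \<open>rsk_P\<close> does.\<close>

lemma unbr_snoc:
  "unbr i pos c (w @ [x]) =
     unbr i pos c w @ (if x = i \<and> open_count i c w = 0 then [pos + length w] else [])"
  by (induction w arbitrary: pos c) (auto simp: open_count_def)

definition dyck_letter :: "nat \<Rightarrow> nat \<Rightarrow> nat \<Rightarrow> nat" where
  "dyck_letter i m x = (if x \<in> {i..i+m} then i else if x \<in> {i+m+1..i+2*m} then Suc i else x)"

text \<open>Ties a prefix of the reading word to \<open>dyck_tab i m p q s\<close>: the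
  \<open>s - q\<close> b's of the bottom row are the open brackets, and the last two clauses say
  that the a's and the b's are each read in increasing order.\<close>

definition dyck_inv :: "nat \<Rightarrow> nat \<Rightarrow> nat list \<Rightarrow> nat \<Rightarrow> nat \<Rightarrow> nat \<Rightarrow> bool" where
  "dyck_inv i m W p q s \<longleftrightarrow>
    set W \<inter> {i..i+m} = {i..<i+p} \<and> set W \<inter> {i+m+1..i+2*m} = {i+m+1..<i+m+1+s} \<and>
    open_count i 0 (map (dyck_letter i m) W) = s - q \<and>
    (\<forall>t<length W. W ! t \<in> {i..i+m} \<longrightarrow> set (take t W) \<inter> {i..i+m} = {i..<W ! t}) \<and>
    (\<forall>t<length W. W ! t \<in> {i+m+1..i+2*m} \<longrightarrow> set (take t W) \<inter> {i+m+1..i+2*m} = {i+m+1..<W ! t})"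

definition all_matched :: "nat \<Rightarrow> nat \<Rightarrow> nat list \<Rightarrow> bool" where
  "all_matched i m W \<longleftrightarrow> unbr i 0 0 (map (dyck_letter i m) W) = [] \<and>
     (\<forall>t<length W. \<forall>j\<le>m. W ! t = i+j \<longrightarrow> i+m+1+j \<in> set (take t W))"

text \<open>The index shift at \<open>k\<close> comes from the free letter: before it, a bracketed
  a_j is preceded by at least j+1 b's; after it, one of the a's has used no b, and only j are
  guaranteed. For \<open>k = m\<close> the next b would lie outside the interval.\<close>

definition unmatched_at :: "nat \<Rightarrow> nat \<Rightarrow> nat list \<Rightarrow> nat \<Rightarrow> nat \<Rightarrow> bool" where
  "unmatched_at i m W k u \<longleftrightarrow> u < length W \<and> W ! u = i+k \<and> k \<le> m \<and>
     unbr i 0 0 (map (dyck_letter i m) W) = [u] \<and> (k < m \<longrightarrow> i+m+1+k \<notin> set (take u W)) \<and>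
     (\<forall>t<length W. \<forall>j\<le>m. W ! t = i+j \<longrightarrow>
        (j < k \<longrightarrow> i+m+1+j \<in> set (take t W)) \<and> (k < j \<longrightarrow> i+m+j \<in> set (take t W)))"

lemma all_snoc:
  "(\<forall>t<length (W @ [x]). Q t (take t (W @ [x])) ((W @ [x]) ! t)) \<longleftrightarrow>
   (\<forall>t<length W. Q t (take t W) (W ! t)) \<and> Q (length W) W x"
  by (auto simp: less_Suc_eq nth_append)

lemma dyck_inv_snoc:
  "dyck_inv i m (W @ [x]) p q s \<longleftrightarrow>
    set (W @ [x]) \<inter> {i..i+m} = {i..<i+p} \<and> set (W @ [x]) \<inter> {i+m+1..i+2*m} = {i+m+1..<i+m+1+s} \<and>
    open_count i 0 (map (dyck_letter i m) (W @ [x])) = s - q \<and>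
    (\<forall>t<length W. W ! t \<in> {i..i+m} \<longrightarrow> set (take t W) \<inter> {i..i+m} = {i..<W ! t}) \<and>
    (x \<in> {i..i+m} \<longrightarrow> set W \<inter> {i..i+m} = {i..<x}) \<and>
    (\<forall>t<length W. W ! t \<in> {i+m+1..i+2*m} \<longrightarrow> set (take t W) \<inter> {i+m+1..i+2*m} = {i+m+1..<W ! t}) \<and>
    (x \<in> {i+m+1..i+2*m} \<longrightarrow> set W \<inter> {i+m+1..i+2*m} = {i+m+1..<x})"
  unfolding dyck_inv_def
  using all_snoc[of W x "\<lambda>_ w y. y \<in> {i..i+m} \<longrightarrow> set w \<inter> {i..i+m} = {i..<y}"]
    all_snoc[of W x "\<lambda>_ w y. y \<in> {i+m+1..i+2*m} \<longrightarrow> set w \<inter> {i+m+1..i+2*m} = {i+m+1..<y}"]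
  by argo

lemma all_matched_snoc:
  "all_matched i m (W @ [x]) \<longleftrightarrow> all_matched i m W \<and>
     \<not> (dyck_letter i m x = i \<and> open_count i 0 (map (dyck_letter i m) W) = 0) \<and>
     (\<forall>j\<le>m. x = i+j \<longrightarrow> i+m+1+j \<in> set W)"
  unfolding all_matched_def
  using all_snoc[of W x "\<lambda>_ w y. \<forall>j\<le>m. y = i+j \<longrightarrow> i+m+1+j \<in> set w"]
  by (auto simp: unbr_snoc)

lemma unmatched_at_snoc:
  assumes "unmatched_at i m W k u"
    and "\<not> (dyck_letter i m x = i \<and> open_count i 0 (map (dyck_letter i m) W) = 0)"
    and "\<forall>j\<le>m. x = i+j \<longrightarrow> (j < k \<longrightarrow> i+m+1+j \<in> set W) \<and> (k < j \<longrightarrow> i+m+j \<in> set W)"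
  shows "unmatched_at i m (W @ [x]) k u"
  using assms unfolding unmatched_at_def
    all_snoc[of W x "\<lambda>_ w y. \<forall>j\<le>m. y = i+j \<longrightarrow>
        (j < k \<longrightarrow> i+m+1+j \<in> set w) \<and> (k < j \<longrightarrow> i+m+j \<in> set w)"]
  by (auto simp: unbr_snoc nth_append)

lemma unmatched_at_new:
  assumes "all_matched i m W" "x = i+k" "k \<le> m" "open_count i 0 (map (dyck_letter i m) W) = 0"
    "k < m \<longrightarrow> i+m+1+k \<notin> set W" "set W \<inter> {i..i+m} = {i..<i+k}"
  shows "unmatched_at i m (W @ [x]) k (length W)"
proof -
  have "dyck_letter i m x = i" using assms unfolding dyck_letter_def by simp
  moreover have "j < k" if "t < length W" "W ! t = i+j" "j \<le> m" for t j
  proof -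
    have "i+j \<in> set W \<inter> {i..i+m}" using that nth_mem[of t W] by auto
    then show ?thesis unfolding assms(6) by simp
  qed
  ultimately show ?thesis using assms(1-5) unfolding unmatched_at_def
    all_snoc[of W x "\<lambda>_ w y. \<forall>j\<le>m. y = i+j \<longrightarrow>
        (j < k \<longrightarrow> i+m+1+j \<in> set w) \<and> (k < j \<longrightarrow> i+m+j \<in> set w)"]
    by (auto simp: unbr_snoc all_matched_def) (metis less_imp_not_less)
qed

text \<open>Induction on the last letter, undoing one insertion at a time. The bound
  \<open>p \<le> Suc q\<close> makes the free letter unique: a free insertion starts from
  \<open>p - 1 = q\<close>, and afterwards \<open>p = Suc q\<close> persists, since a bump raises
  both counts.\<close>

lemma rsk_dyck_tab_invariant:
  assumes m: "1 \<le> m"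
  shows "rsk_P (filter (\<lambda>x. x \<in> {i..i+2*m}) W) = dyck_tab i m p q s \<Longrightarrow>
    p \<le> Suc q \<Longrightarrow> p \<le> Suc m \<Longrightarrow> q \<le> s \<Longrightarrow> s \<le> m \<Longrightarrow>
    dyck_inv i m W p q s \<and> (p = q \<and> all_matched i m W \<or> p = Suc q \<and> (\<exists>k u. unmatched_at i m W k u))"
proof (induction W arbitrary: p q s rule: rev_induct)
  case Nil
  then have "dyck_tab i m p q s = []" by (simp add: rsk_P_def)
  then have "q = 0" "p = 0" "s = 0" unfolding dyck_tab_def Let_def by (auto split: if_splits)
  then show ?case by (simp add: dyck_inv_def all_matched_def open_count_def)
next
  case (snoc x W)
  show ?case
  proof (cases "x \<in> {i..i+2*m}")
    case False
    \<comment> \<open>A letter outside the interval differs from \<open>i\<close> and from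
      \<open>Suc i\<close>, which lies inside as \<open>m \<ge> 1\<close>; so the bracketing ignores
      it.\<close>
    then have x: "dyck_letter i m x = x" "x \<notin> {i..i+m}" "x \<notin> {i+m+1..i+2*m}" "x \<noteq> i" "x \<noteq> Suc i"
      using m by (auto simp: dyck_letter_def)
    have IH: "dyck_inv i m W p q s \<and> (p = q \<and> all_matched i m W \<or> p = Suc q \<and> (\<exists>k u. unmatched_at i m W k u))"
    proof -
      have "filter (\<lambda>x. x \<in> {i..i+2*m}) (W @ [x]) = filter (\<lambda>x. x \<in> {i..i+2*m}) W" using False by simp
      then show ?thesis using snoc.IH[of p q s] snoc.prems by argo
    qed
    have "set (W @ [x]) \<inter> {i..i+m} = set W \<inter> {i..i+m}"
      "set (W @ [x]) \<inter> {i+m+1..i+2*m} = set W \<inter> {i+m+1..i+2*m}" using x by auto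
    moreover have "open_count i 0 (map (dyck_letter i m) (W @ [x])) = open_count i 0 (map (dyck_letter i m) W)"
      using x by simp
    ultimately have "dyck_inv i m (W @ [x]) p q s"
      unfolding dyck_inv_snoc using IH x(2,3) unfolding dyck_inv_def by argo
    moreover have "all_matched i m W \<Longrightarrow> all_matched i m (W @ [x])"
      unfolding all_matched_snoc using x by auto
    moreover have "unmatched_at i m W k u \<Longrightarrow> unmatched_at i m (W @ [x]) k u" for k u
      using unmatched_at_snoc[of i m W k u x] x by auto
    ultimately show ?thesis using IH by blast
  next
    case True
    let ?P = "rsk_P (filter (\<lambda>x. x \<in> {i..i+2*m}) W)"
    have "rsk_ins x ?P = dyck_tab i m p q s" using snoc.prems(1) True by (simp add: rsk_P_snoc)
    then show ?thesis using rsk_P_rows_ok snoc.prems(4,3)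
    proof (cases rule: rsk_ins_dyck_tab)
      case B
      have IH: "dyck_inv i m W p q (s - 1)"
        "p = q \<and> all_matched i m W \<or> p = Suc q \<and> (\<exists>k u. unmatched_at i m W k u)"
      proof -
        have "q \<le> s - 1" "s - 1 \<le> m" using B(1) snoc.prems(5) by auto
        then show "dyck_inv i m W p q (s - 1)"
          "p = q \<and> all_matched i m W \<or> p = Suc q \<and> (\<exists>k u. unmatched_at i m W k u)"
          using snoc.IH[OF B(3) snoc.prems(2,3)] by blast+
      qed
      have x: "dyck_letter i m x = Suc i" "x \<notin> {i..i+m}" "x \<in> {i+m+1..i+2*m}"
        using B snoc.prems(5) unfolding dyck_letter_def by auto
      have "insert x {i+m+1..<i+m+1+(s-1)} = {i+m+1..<i+m+1+s}" using B(1,2) by auto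
      then have "dyck_inv i m (W @ [x]) p q s"
        unfolding dyck_inv_snoc using IH(1) x B(1,2) unfolding dyck_inv_def by auto
      moreover have "all_matched i m W \<Longrightarrow> all_matched i m (W @ [x])"
        unfolding all_matched_snoc using x by auto
      moreover have "unmatched_at i m W k u \<Longrightarrow> unmatched_at i m (W @ [x]) k u" for k u
        using unmatched_at_snoc[of i m W k u x] x by auto
      ultimately show ?thesis using IH(2) by blast
    next
      case free
      have IH: "dyck_inv i m W (p - 1) q s" "p - 1 = q" "all_matched i m W"
      proof -
        have "p - 1 \<le> Suc q" "p - 1 \<le> Suc m" "p - 1 \<noteq> Suc q" using snoc.prems(2,3) free(2) by auto
        then show "dyck_inv i m W (p - 1) q s" "p - 1 = q" "all_matched i m W"
          using snoc.IH[OF free(4) _ _ snoc.prems(4,5)] by blast+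
      qed
      have x: "dyck_letter i m x = i" "x \<in> {i..i+m}" "x \<notin> {i+m+1..i+2*m}" "x = i+q" "q \<le> m" "p = Suc q"
        using free IH(2) snoc.prems unfolding dyck_letter_def by auto
      have "insert x {i..<i+(p-1)} = {i..<i+p}" using x by auto
      then have "dyck_inv i m (W @ [x]) p q s"
        unfolding dyck_inv_snoc using IH(1) x free(1) unfolding dyck_inv_def by auto
      \<comment> \<open>At a free step all \<open>s = q\<close> b's read so far have been bumped, so
        the next b has not been read.\<close>
      moreover have "q < m \<longrightarrow> i+m+1+q \<notin> set W"
      proof (intro impI notI)
        assume "i+m+1+q \<in> set W" "q < m"
        then have "i+m+1+q \<in> set W \<inter> {i+m+1..i+2*m}" by auto
        then show False using IH(1) free(1) unfolding dyck_inv_def by auto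
      qed
      ultimately show ?thesis using unmatched_at_new[OF IH(3) x(4,5)] IH(1) free(1) x(6) unfolding dyck_inv_def by auto
    next
      case bump
      have IH: "dyck_inv i m W (p - 1) (q - 1) s"
        "p = q \<and> all_matched i m W \<or> p = Suc q \<and> (\<exists>k u. unmatched_at i m W k u)"
      proof -
        have "p - 1 \<le> Suc (q - 1)" "p - 1 \<le> Suc m" "q - 1 \<le> s"
          "p - 1 = q - 1 \<longleftrightarrow> p = q" "p - 1 = Suc (q - 1) \<longleftrightarrow> p = Suc q"
          using snoc.prems(2,3,4) bump(1,2) by auto
        then show "dyck_inv i m W (p - 1) (q - 1) s"
          "p = q \<and> all_matched i m W \<or> p = Suc q \<and> (\<exists>k u. unmatched_at i m W k u)"
          using snoc.IH[OF bump(4) _ _ _ snoc.prems(5)] by blast+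
      qed
      have x: "dyck_letter i m x = i" "x \<in> {i..i+m}" "x \<notin> {i+m+1..i+2*m}" "x = i+(p-1)"
        using bump snoc.prems unfolding dyck_letter_def by auto
      have oc: "open_count i 0 (map (dyck_letter i m) W) = s - (q - 1)" and
        sA: "set W \<inter> {i..i+m} = {i..<i+(p-1)}" and sB: "set W \<inter> {i+m+1..i+2*m} = {i+m+1..<i+m+1+s}"
        using IH(1) unfolding dyck_inv_def by auto
      have pos: "open_count i 0 (map (dyck_letter i m) W) > 0" using oc bump(1) snoc.prems(4) by simp
      have inW: "v \<in> set W" if "i+m+1 \<le> v" "v < i+m+1+s" for v using sB that by auto
      have "insert x {i..<i+(p-1)} = {i..<i+p}" using x bump by auto
      then have "dyck_inv i m (W @ [x]) p q s"
        unfolding dyck_inv_snoc using IH(1) x bump(1) unfolding dyck_inv_def by auto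
      moreover have "all_matched i m (W @ [x])" if "p = q" "all_matched i m W"
        unfolding all_matched_snoc using that pos x(4) inW bump snoc.prems(4) by auto
      moreover have "unmatched_at i m (W @ [x]) k u" if "p = Suc q" "unmatched_at i m W k u" for k u
      proof (rule unmatched_at_snoc[OF that(2)])
        \<comment> \<open>The free letter has already been read, so the new a has a larger index and
          falls under the shifted clause.\<close>
        have "i+k \<in> set W \<inter> {i..i+m}" using that(2) nth_mem[of u W] unfolding unmatched_at_def by auto
        then have "k < p - 1" unfolding sA by simp
        then show "\<forall>j\<le>m. x = i+j \<longrightarrow> (j < k \<longrightarrow> i+m+1+j \<in> set W) \<and> (k < j \<longrightarrow> i+m+j \<in> set W)"
          using x(4) inW[of "i+m+(p-1)"] that(1) snoc.prems(4) by auto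
      qed (use pos in simp)
      ultimately show ?thesis using IH(2) by blast
    qed
  qed
qed

subsection \<open>Descents and rectangles in terms of reading positions\<close>

lemma less_interval_of_step:
  fixes f :: "nat \<Rightarrow> nat"
  assumes "\<And>d. a \<le> d \<Longrightarrow> d < b \<Longrightarrow> f d < f (Suc d)" "a \<le> x" "x < y" "y \<le> b"
  shows "f x < f y"
  using assms(3,4)
proof (induction y)
  case (Suc y)
  then show ?case using assms(1)[of y] assms(2) by (cases "x = y") auto
qed simp

text \<open>\<open>P x\<close> stands for the reading position of \<open>x\<close> and
  \<open>k\<close> for the index of the free letter, so that tableaux no longer enter.
  \<open>mid\<close> is conditional because for \<open>k = m\<close> the next b would be
  i+2m+1.\<close>

locale dyck_order =
  fixes P :: "nat \<Rightarrow> nat" and N i m k :: nat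
  assumes m: "1 \<le> m" and i: "1 \<le> i" and N: "i+2*m \<le> N" and k: "k \<le> m"
    and inj: "inj_on P {1..N}"
    and A: "\<And>x y. i \<le> x \<Longrightarrow> x < y \<Longrightarrow> y \<le> i+m \<Longrightarrow> P x < P y"
    and B: "\<And>x y. i+m+1 \<le> x \<Longrightarrow> x < y \<Longrightarrow> y \<le> i+2*m \<Longrightarrow> P x < P y"
    and lo: "\<And>j. j < k \<Longrightarrow> P (i+m+1+j) < P (i+j)"
    and mid: "k < m \<Longrightarrow> P (i+k) < P (i+m+1+k)"
    and hi: "\<And>j. k < j \<Longrightarrow> j \<le> m \<Longrightarrow> P (i+m+j) < P (i+j)"
begin

text \<open>\<open>src d\<close> is the entry of $T$ in the cell that carries \<open>d\<close> in $T'$.\<close>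

definition src :: "nat \<Rightarrow> nat" where
  "src d = (if i+k \<le> d \<and> d < i+m+k then d + 1 else if d = i+m+k then i+k else d)"

lemma ne: "x \<in> {1..N} \<Longrightarrow> y \<in> {1..N} \<Longrightarrow> x \<noteq> y \<Longrightarrow> P x \<noteq> P y"
  using inj unfolding inj_on_def by blast

text \<open>For \<open>k < m\<close> this is the bracketing of the last a; for \<open>k = m\<close>
  the last b even precedes the a before it.\<close>

lemma last_B_before_last_A: "P (i+2*m) < P (i+m)"
proof (cases "k = m")
  case True
  then have "P (i+2*m) < P (i+(m-1))" using lo[of "m-1"] m by (simp add: mult_2 add.assoc)
  also have "\<dots> < P (i+m)" using A[of "i+(m-1)" "i+m"] m by simp
  finally show ?thesis .
next
  case False
  then show ?thesis using hi[of m] k by (simp add: mult_2 add.assoc)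
qed

lemma src_ascent_A:
  assumes "i \<le> d" "d < i+m-1" shows "P (src d) < P (src (Suc d))"
proof -
  have "src d \<in> {i..i+m}" "src (Suc d) \<in> {i..i+m}" "src d < src (Suc d)"
    using assms k unfolding src_def by auto
  then show ?thesis using A by auto
qed

text \<open>In \<open>T'\<close> the upper run consists of the b's with the converted a_k inserted
  between b_k and b_{k+1}, which is where the reading order has it.\<close>

lemma src_ascent_B:
  assumes "i+m \<le> d" "d < i+2*m" shows "P (src d) < P (src (Suc d))"
proof -
  consider "Suc d < i+m+k" | "Suc d = i+m+k" | "d = i+m+k" | "i+m+k < d" by linarith
  then show ?thesis
  proof cases
    case 1
    then show ?thesis using B[of "d+1" "d+2"] assms k unfolding src_def by simp
  next
    case 2
    then have s: "src d = i+m+k" "src (Suc d) = i+k" "0 < k" using assms unfolding src_def by auto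
    have "P (i+m+k) < P (i+(k-1))" using lo[of "k-1"] s(3) by simp
    also have "\<dots> < P (i+k)" using A[of "i+(k-1)" "i+k"] s(3) k by simp
    finally show ?thesis using s by simp
  next
    case 3
    then have "k < m" using assms by simp
    then show ?thesis using mid 3 m unfolding src_def by simp
  next
    case 4
    then show ?thesis using B[of d "Suc d"] assms m unfolding src_def by simp
  qed
qed

lemma src_descent: "P (src (i+m)) < P (src (i+m-1))"
proof -
  consider "k = 0" | "0 < k" "k < m" | "k = m" using k by linarith
  then show ?thesis
  proof cases
    case 1
    then have "src (i+m) = i" "src (i+m-1) = i+m" using m unfolding src_def by auto
    then show ?thesis using A[of i "i+m"] m by simp
  next
    case 2
    then have s: "src (i+m) = i+m+1" "src (i+m-1) = i+m" using m unfolding src_def by auto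
    have "P (i+m+1) \<le> P (i+2*m)" using B[of "i+m+1" "i+2*m"] m by (cases "m = 1") auto
    then show ?thesis using s last_B_before_last_A by simp
  next
    case 3
    then have s: "src (i+m) = i+m+1" "src (i+m-1) = i+m-1" using m unfolding src_def by auto
    have "P (i+m+1) < P i" using lo[of 0] 3 m by simp
    also have "P i \<le> P (i+m-1)"
    proof (cases "m = 1")
      case False
      then have "i < i+m-1" using m by linarith
      then show ?thesis using A[of i "i+m-1"] by simp
    qed simp
    finally show ?thesis using s by simp
  qed
qed

lemma src_order_A: "i \<le> x \<Longrightarrow> x < y \<Longrightarrow> y < i+m \<Longrightarrow> P (src x) < P (src y)"
  using less_interval_of_step[of i "i+m-1" "\<lambda>d. P (src d)"] src_ascent_A by auto

lemma src_order_B: "i+m \<le> x \<Longrightarrow> x < y \<Longrightarrow> y \<le> i+2*m \<Longrightarrow> P (src x) < P (src y)"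
  using less_interval_of_step[of "i+m" "i+2*m" "\<lambda>d. P (src d)"] src_ascent_B by auto

lemma src_bij: "bij_betw src {1..N} {1..N}"
proof -
  have "inj_on src {1..N}" unfolding src_def inj_on_def by auto
  moreover have "src ` {1..N} \<subseteq> {1..N}" using i N m k unfolding src_def by auto
  ultimately show ?thesis unfolding bij_betw_def
    by (metis card_image card_subset_eq finite_atLeastAtMost)
qed

definition desc :: "nat set" where "desc = {d. 1 \<le> d \<and> d < N \<and> P (Suc d) < P d}"
definition desc' :: "nat set" where "desc' = {d. 1 \<le> d \<and> d < N \<and> P (src (Suc d)) < P (src d)}"

text \<open>\<open>right_rect\<close> and \<open>left_rect\<close> record when a boundary descent
  appears or disappears; they are named for the rectangles to which \<open>right_rect_iff\<close>
  and \<open>left_rect_iff\<close> show them equivalent.\<close>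

definition right_rect :: bool where
  "right_rect \<longleftrightarrow> i+2*m < N \<and> k = m \<and> P (i+2*m) < P (i+2*m+1) \<and> P (i+2*m+1) < P (i+m)"
definition left_rect :: bool where
  "left_rect \<longleftrightarrow> 1 < i \<and> k = 0 \<and> P i < P (i-1) \<and> P (i-1) < P (i+1)"

lemma desc_facts:
  "i \<le> d \<Longrightarrow> d < i+m \<Longrightarrow> d \<notin> desc"
  "i+m \<in> desc"
  "i+m < d \<Longrightarrow> d < i+2*m \<Longrightarrow> d \<notin> desc"
  "left_rect \<Longrightarrow> i-1 \<in> desc"
  "right_rect \<Longrightarrow> i+2*m \<notin> desc"
proof -
  show "i \<le> d \<Longrightarrow> d < i+m \<Longrightarrow> d \<notin> desc" using A[of d "Suc d"] unfolding desc_def by auto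
  show "i+m < d \<Longrightarrow> d < i+2*m \<Longrightarrow> d \<notin> desc" using B[of d "Suc d"] unfolding desc_def by auto
  show "left_rect \<Longrightarrow> i-1 \<in> desc" using N m unfolding desc_def left_rect_def by auto
  show "right_rect \<Longrightarrow> i+2*m \<notin> desc" unfolding desc_def right_rect_def by auto
  have "P (i+m+1) \<le> P (i+2*m)" using B[of "i+m+1" "i+2*m"] m by (cases "m = 1") auto
  then show "i+m \<in> desc" unfolding desc_def using last_B_before_last_A m i N by simp
qed

lemma desc'_facts:
  "d < i-1 \<Longrightarrow> d \<in> desc' \<longleftrightarrow> d \<in> desc"
  "i+2*m < d \<Longrightarrow> d \<in> desc' \<longleftrightarrow> d \<in> desc"
  "i \<le> d \<Longrightarrow> d < i+m-1 \<Longrightarrow> d \<notin> desc'"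
  "i+m-1 \<in> desc'"
  "i+m \<le> d \<Longrightarrow> d < i+2*m \<Longrightarrow> d \<notin> desc'"
  "i-1 \<in> desc' \<longleftrightarrow> i-1 \<in> desc \<and> \<not> left_rect"
  "i+2*m \<in> desc' \<longleftrightarrow> i+2*m \<in> desc \<or> right_rect"
proof -
  show "d < i-1 \<Longrightarrow> d \<in> desc' \<longleftrightarrow> d \<in> desc" unfolding desc_def desc'_def src_def by auto
  show "i+2*m < d \<Longrightarrow> d \<in> desc' \<longleftrightarrow> d \<in> desc" using k unfolding desc_def desc'_def src_def by auto
  show "i \<le> d \<Longrightarrow> d < i+m-1 \<Longrightarrow> d \<notin> desc'" using src_ascent_A[of d] unfolding desc'_def by auto
  show "i+m \<le> d \<Longrightarrow> d < i+2*m \<Longrightarrow> d \<notin> desc'" using src_ascent_B[of d] unfolding desc'_def by auto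
  show "i+m-1 \<in> desc'" using src_descent m i N unfolding desc'_def by auto
  show "i-1 \<in> desc' \<longleftrightarrow> i-1 \<in> desc \<and> \<not> left_rect"
  \<comment> \<open>Here \<open>i-1\<close> is 0, which is never a descent, and
    \<open>left_rect\<close> requires \<open>1 < i\<close>.\<close>
  proof (cases "i = 1")
    case True
    then show ?thesis unfolding desc_def desc'_def by simp
  next
    case False
    then have s: "1 < i" "src (i-1) = i-1" "src i = (if k = 0 then i+1 else i)" "Suc (i-1) = i"
      using i m unfolding src_def by auto
    have "P i < P (i+1)" using A[of i "i+1"] m by simp
    moreover have "P (i-1) \<noteq> P (i+1)"
    proof (rule ne)
      show "i-1 \<in> {1..N}" "i+1 \<in> {1..N}" "i-1 \<noteq> i+1" using s(1) m N by auto
    qed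
    ultimately show ?thesis using s N m unfolding desc_def desc'_def left_rect_def by auto
  qed
  show "i+2*m \<in> desc' \<longleftrightarrow> i+2*m \<in> desc \<or> right_rect"
  proof (cases "i+2*m < N")
    case False
    then show ?thesis unfolding desc_def desc'_def right_rect_def by simp
  next
    case True
    have s: "src (i+2*m) = (if k = m then i+m else i+2*m)" "src (Suc (i+2*m)) = i+2*m+1"
      using k m unfolding src_def by auto
    have "P (i+2*m) \<noteq> P (i+2*m+1)" using ne[of "i+2*m" "i+2*m+1"] i True by auto
    then show ?thesis using s last_B_before_last_A i True unfolding desc_def desc'_def right_rect_def by auto
  qed
qed

section \<open>Rectangles expressed by reading positions\<close>

definition inc_set :: "nat set \<Rightarrow> bool" where
  "inc_set S \<longleftrightarrow> (\<forall>x\<in>S. \<forall>y\<in>S. x < y \<longrightarrow> P x < P y)"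
definition has_dec :: "nat set \<Rightarrow> bool" where
  "has_dec V \<longleftrightarrow> (\<exists>x\<in>V. \<exists>y\<in>V. \<exists>z\<in>V. x < y \<and> y < z \<and> P z < P y \<and> P y < P x)"

lemma card_le_of_inj_A:
  assumes "inj_on g S" "g ` S \<subseteq> {i..i+m}" shows "card S \<noteq> m + 2"
proof -
  have "card S \<le> card {i..i+m}" by (rule card_inj_on_le[OF assms]) simp
  then show ?thesis by simp
qed

text \<open>Forwards, \<open>g\<close> folds each inverted pair (a_j, b_{j+1}), with i+2m+1 in the
  role of b_{m+1}, into one pigeonhole. Backwards, each failing clause has its witness: the a's
  followed by i+2m+1, the decreasing triple on a_m, b_m, i+2m+1, or for \<open>k < m\<close> a chain
  that changes over at the free letter.\<close>

lemma right_rect_iff: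
  assumes z: "i+2*m < N"
  shows "right_rect \<longleftrightarrow>
    \<not> has_dec {i..i+2*m+1} \<and> \<not> (\<exists>S\<subseteq>{i..i+2*m+1}. card S = m + 2 \<and> inc_set S)"
proof
  assume r: right_rect
  then have r: "k = m" "P (i+2*m) < P (i+2*m+1)" "P (i+2*m+1) < P (i+m)" unfolding right_rect_def by auto
  have "\<not> has_dec {i..i+2*m+1}"
  proof
    assume "has_dec {i..i+2*m+1}"
    then obtain x y w where d: "i \<le> x" "w \<le> i+2*m+1" "x < y" "y < w" "P w < P y" "P y < P x"
      unfolding has_dec_def by auto
    have y: "i+m < y" using A[of x y] d by force
    have w: "w = i+2*m+1" using B[of y w] d y by force
    have "P y \<le> P (i+2*m)" using B[of y "i+2*m"] y w d by (cases "y = i+2*m") auto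
    then show False using d w r by simp
  qed
  moreover have "card S \<noteq> m + 2" if S: "S \<subseteq> {i..i+2*m+1}" "inc_set S" for S
  proof -
    define g where "g x = (if x \<le> i+m then x else x - (m+1))" for x
    have no: "\<not> (x \<in> S \<and> x + (m+1) \<in> S)" if "i \<le> x" "x \<le> i+m" for x
    proof
      assume x: "x \<in> S \<and> x + (m+1) \<in> S"
      then have "P x < P (x + (m+1))" using S(2) unfolding inc_set_def by simp
      moreover have "P (x + (m+1)) < P x"
      proof (cases "x = i+m")
        case True then show ?thesis using r by (simp add: mult_2 add.assoc)
      next
        case False
        then have "x - i < k" "i + m + 1 + (x - i) = x + (m+1)" "i + (x - i) = x" using that r by auto
        then show ?thesis using lo[of "x - i"] by metis
      qed
      ultimately show False by simp
    qed
    have "inj_on g S"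
    proof (rule inj_onI)
      fix x y assume xy: "x \<in> S" "y \<in> S" "g x = g y"
      have "x \<in> {i..i+2*m+1}" "y \<in> {i..i+2*m+1}" using xy S(1) by auto
      then show "x = y" using xy(3) no[of x] no[of y] xy(1,2) unfolding g_def by (auto split: if_splits)
    qed
    moreover have "g ` S \<subseteq> {i..i+m}"
    proof (rule image_subsetI)
      fix x assume "x \<in> S"
      then have "x \<in> {i..i+2*m+1}" using S(1) by blast
      then show "g x \<in> {i..i+m}" unfolding g_def by auto
    qed
    ultimately show ?thesis using card_le_of_inj_A by blast
  qed
  ultimately show "\<not> has_dec {i..i+2*m+1} \<and> \<not> (\<exists>S\<subseteq>{i..i+2*m+1}. card S = m + 2 \<and> inc_set S)" by blast
next
  assume h: "\<not> has_dec {i..i+2*m+1} \<and> \<not> (\<exists>S\<subseteq>{i..i+2*m+1}. card S = m + 2 \<and> inc_set S)"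
  have noinc: "\<not> inc_set S" if "S \<subseteq> {i..i+2*m+1}" "card S = m + 2" for S using h that by blast
  have 1: "P (i+2*m+1) < P (i+m)"
  proof (rule ccontr)
    assume "\<not> P (i+2*m+1) < P (i+m)"
    then have lt: "P (i+m) < P (i+2*m+1)" using ne[of "i+m" "i+2*m+1"] i m z by force
    have "P x < P (i+2*m+1)" if "i \<le> x" "x \<le> i+m" for x
      using A[of x "i+m"] that lt by (cases "x = i+m") auto
    then have "inc_set ({i..i+m} \<union> {i+2*m+1})" using A unfolding inc_set_def by auto
    moreover have "card ({i..i+m} \<union> {i+2*m+1}) = m + 2" by simp
    ultimately show False using noinc[of "{i..i+m} \<union> {i+2*m+1}"] by auto
  qed
  have 2: "P (i+2*m) < P (i+2*m+1)"
  proof (rule ccontr)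
    assume "\<not> P (i+2*m) < P (i+2*m+1)"
    then have lt: "P (i+2*m+1) < P (i+2*m)" using ne[of "i+2*m" "i+2*m+1"] i m z by force
    have "has_dec {i..i+2*m+1}" unfolding has_dec_def using lt last_B_before_last_A m
      by (intro bexI[of _ "i+m"] bexI[of _ "i+2*m"] bexI[of _ "i+2*m+1"]) auto
    then show False using h by blast
  qed
  have "k = m"
  proof (rule ccontr)
    assume "k \<noteq> m"
    then have km: "k < m" using k by simp
    \<comment> \<open>These are a_0, ..., a_k, then b_{k+1}, ..., b_m, then i+2m+1, which makes
      (k+1) + (m-k) + 1 = m+2 elements.\<close>
    let ?S = "{i..i+k} \<union> {i+m+1+k..i+2*m+1}"
    have b: "P x < P y" if "i+m+1+k \<le> x" "x < y" "y \<le> i+2*m+1" for x y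
    proof (cases "y = i+2*m+1")
      case False then show ?thesis using B[of x y] that by simp
    next
      case True
      have "P x \<le> P (i+2*m)" using B[of x "i+2*m"] that True by (cases "x = i+2*m") auto
      then show ?thesis using 2 True by simp
    qed
    have ab: "P x < P y" if "i \<le> x" "x \<le> i+k" "i+m+1+k \<le> y" "y \<le> i+2*m+1" for x y
    proof -
      have "P x \<le> P (i+k)" using A[of x "i+k"] that km by (cases "x = i+k") auto
      moreover have "P (i+m+1+k) \<le> P y" using b[of "i+m+1+k" y] that by (cases "y = i+m+1+k") auto
      ultimately show ?thesis using mid[OF km] by simp
    qed
    have "inc_set ?S" unfolding inc_set_def using A b ab km by auto
    moreover have "card ?S = m + 2"
    proof -
      have "card ?S = card {i..i+k} + card {i+m+1+k..i+2*m+1}" by (rule card_Un_disjoint) (use km in auto)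
      then show ?thesis using km by simp
    qed
    ultimately show False using noinc[of ?S] km by auto
  qed
  then show right_rect using 1 2 z unfolding right_rect_def by simp
qed

text \<open>The pairs are now (i-1, a_0) and (a_j, b_j): \<open>g\<close> sends i-1 to i and b_j to
  i+j. Backwards, the long chain is i-1, a_0, ..., a_m; the decreasing triples are i-1, a_0, b_1 if
  \<open>k > 0\<close>, and i-1, a_1, b_1 if a_1 is read before i-1.\<close>

lemma left_rect_iff:
  assumes z: "1 < i"
  shows "left_rect \<longleftrightarrow>
    \<not> has_dec {i-1..i+2*m} \<and> \<not> (\<exists>S\<subseteq>{i-1..i+2*m}. card S = m + 2 \<and> inc_set S)"
proof
  assume r: left_rect
  then have r: "k = 0" "P i < P (i-1)" "P (i-1) < P (i+1)" unfolding left_rect_def by auto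
  have "\<not> has_dec {i-1..i+2*m}"
  proof
    assume "has_dec {i-1..i+2*m}"
    then obtain x y w where d: "i-1 \<le> x" "w \<le> i+2*m" "x < y" "y < w" "P w < P y" "P y < P x"
      unfolding has_dec_def by auto
    have y: "y \<le> i+m" using B[of y w] d by force
    have x: "x = i-1" using A[of x y] d y by force
    have w: "i+m < w" using A[of y w] d x by force
    have "y = i"
    proof (rule ccontr)
      assume "y \<noteq> i"
      then have "i+1 \<le> y" using d(3) x z by linarith
      then have "P (i+1) \<le> P y" using A[of "i+1" y] y by (cases "y = i+1") auto
      then show False using d x r by simp
    qed
    moreover have "P (i+m+1) \<le> P w" using B[of "i+m+1" w] w d by (cases "w = i+m+1") auto
    ultimately show False using mid r m d by simp
  qed
  moreover have "card S \<noteq> m + 2" if S: "S \<subseteq> {i-1..i+2*m}" "inc_set S" for S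
  proof -
    define g where "g x = (if x < i then i else if x \<le> i+m then x else x - m)" for x
    have no: "\<not> (x \<in> S \<and> x + m \<in> S)" if "i < x" "x \<le> i+m" for x
    proof
      assume x: "x \<in> S \<and> x + m \<in> S"
      then have "P x < P (x + m)" using S(2) m unfolding inc_set_def by simp
      moreover have "i + m + (x - i) = x + m" "i + (x - i) = x" using that by auto
      moreover have "k < x - i" "x - i \<le> m" using that r by auto
      ultimately show False using hi[of "x - i"] by (metis less_imp_not_less)
    qed
    have no3: "y - m \<notin> S" if "y \<in> S" "\<not> y \<le> i+m" "y \<le> i+2*m" for y
    proof -
      have "i < y - m" "y - m \<le> i+m" "y - m + m = y" using that(2,3) by linarith+
      then show ?thesis using no[of "y - m"] that(1) by simp
    qed
    have no2: "\<not> (i - 1 \<in> S \<and> i \<in> S)"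
      using S(2) r(2) z unfolding inc_set_def by (meson diff_less less_imp_not_less less_trans zero_less_one)
    have "inj_on g S"
    proof (rule inj_onI)
      fix x y assume xy: "x \<in> S" "y \<in> S" "g x = g y"
      have b: "x \<in> {i-1..i+2*m}" "y \<in> {i-1..i+2*m}" using xy S(1) by auto
      then have "x < i \<Longrightarrow> x = i - 1" "y < i \<Longrightarrow> y = i - 1" by auto
      then show "x = y" using b xy(3) no3[of x] no3[of y] no2 xy(1,2) unfolding g_def by (auto split: if_splits)
    qed
    moreover have "g ` S \<subseteq> {i..i+m}"
    proof (rule image_subsetI)
      fix x assume "x \<in> S"
      then have "x \<in> {i-1..i+2*m}" using S(1) by blast
      then show "g x \<in> {i..i+m}" unfolding g_def by auto
    qed
    ultimately show ?thesis using card_le_of_inj_A by blast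
  qed
  ultimately show "\<not> has_dec {i-1..i+2*m} \<and> \<not> (\<exists>S\<subseteq>{i-1..i+2*m}. card S = m + 2 \<and> inc_set S)" by blast
next
  assume h: "\<not> has_dec {i-1..i+2*m} \<and> \<not> (\<exists>S\<subseteq>{i-1..i+2*m}. card S = m + 2 \<and> inc_set S)"
  have nodec: False if "i-1 \<le> x" "w \<le> i+2*m" "x < y" "y < w" "P w < P y" "P y < P x" for x y w
  proof -
    have "x \<in> {i-1..i+2*m}" "y \<in> {i-1..i+2*m}" "w \<in> {i-1..i+2*m}" using that by auto
    then show False using h that(3-) unfolding has_dec_def by blast
  qed
  have 1: "P i < P (i-1)"
  proof (rule ccontr)
    assume "\<not> P i < P (i-1)"
    then have lt: "P (i-1) < P i" using ne[of "i-1" i] z N by force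
    have "P (i-1) < P x" if "i \<le> x" "x \<le> i+m" for x
      using A[of i x] that lt by (cases "x = i") auto
    then have "P x < P y" if "i-1 \<le> x" "x < y" "y \<le> i+m" for x y
      using A[of x y] that by (cases "x = i-1") auto
    then have "inc_set {i-1..i+m}" unfolding inc_set_def by auto
    moreover have "card {i-1..i+m} = m + 2" using z by simp
    moreover have "{i-1..i+m} \<subseteq> {i-1..i+2*m}" by auto
    ultimately show False using h by blast
  qed
  have k0: "k = 0"
  proof (rule ccontr)
    assume "k \<noteq> 0"
    then have "P (i+m+1) < P i" using lo[of 0] by simp
    then show False using 1 z m by (intro nodec[of "i-1" "i+m+1" i]) auto
  qed
  have "P (i-1) < P (i+1)"
  proof (rule ccontr)
    assume "\<not> P (i-1) < P (i+1)"
    then have lt: "P (i+1) < P (i-1)" using ne[of "i-1" "i+1"] z m N by force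
    moreover have "P (i+m+1) < P (i+1)" using hi[of 1] m k0 by simp
    ultimately show False using z m by (intro nodec[of "i-1" "i+m+1" "i+1"]) auto
  qed
  then show left_rect using 1 k0 z unfolding left_rect_def by simp
qed

end

subsection \<open>Edges of the crystal skeleton\<close>

lemma in_set_take_iff_wpos:
  assumes "distinct w" "v \<in> set w" "t \<le> length w"
  shows "v \<in> set (take t w) \<longleftrightarrow> wpos w v < t"
proof
  assume "v \<in> set (take t w)"
  then obtain s where "s < t" "w ! s = v" "s < length w" using assms(3) by (auto simp: in_set_conv_nth)
  then show "wpos w v < t" using wpos_nth[OF assms(1), of s] by simp
next
  assume "wpos w v < t"
  then show "v \<in> set (take t w)"
    using wpos_less[OF assms(1,2)] nth_wpos[OF assms(1,2)] by (auto simp: in_set_conv_nth)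
qed

text \<open>The tableau of a Dyck pattern interval is \<open>dyck_tab\<close> with
  \<open>p = Suc m\<close> and \<open>q = s = m\<close>, so the invariant leaves only the
  alternative with one free letter.\<close>

lemma dyck_interval_order:
  assumes syt: "is_SYT lam T" and dyck: "dyck_interval (rowword T) i m"
  obtains k where "dyck_order (wpos (rowword T)) (sum_list lam) i m k"
    and "unbr i 0 0 (map (dyck_letter i m) (rowword T)) = [wpos (rowword T) (i+k)]"
proof -
  define W where "W = rowword T"
  define N where "N = sum_list lam"
  note w = SYT_rowword[OF syt, folded W_def N_def]
  have b: "1 \<le> m" "1 \<le> i" "i+2*m \<le> N"
    using dyck w(3) unfolding dyck_interval_def W_def[symmetric] by auto
  have "dyck_tab i m (Suc m) m m = [[i..<i+m+1], [i+m+1..<i+2*m+1]]"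
    using b(1) unfolding dyck_tab_def Let_def by (simp add: mult_2 add.assoc del: upt_Suc)
  then have "rsk_P (filter (\<lambda>x. x \<in> {i..i+2*m}) W) = dyck_tab i m (Suc m) m m"
    using dyck unfolding dyck_interval_def W_def by simp
  from rsk_dyck_tab_invariant[OF b(1) this] obtain k u where
    inv: "dyck_inv i m W (Suc m) m m" and um: "unmatched_at i m W k u" by auto
  let ?P = "wpos W"
  have inW: "v \<in> set W" if "i \<le> v" "v \<le> i+2*m" for v using w(2) b that by auto
  have pos: "?P v < length W" "W ! ?P v = v" if "i \<le> v" "v \<le> i+2*m" for v
    using wpos_less[OF w(1)] nth_wpos[OF w(1)] inW[OF that] by auto
  have before: "?P x < ?P y" if "x \<in> set (take (?P y) W)" "i \<le> x" "x \<le> i+2*m" "i \<le> y" "y \<le> i+2*m" for x y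
    using in_set_take_iff_wpos[OF w(1) inW[OF that(2,3)], of "?P y"] pos(1)[OF that(4,5)] that(1) by simp
  have A: "?P x < ?P y" if "i \<le> x" "x < y" "y \<le> i+m" for x y
  proof (rule before)
    have "set (take (?P y) W) \<inter> {i..i+m} = {i..<y}"
      using inv pos[of y] that unfolding dyck_inv_def by simp
    moreover have "x \<in> {i..<y}" using that by simp
    ultimately show "x \<in> set (take (?P y) W)" by blast
  qed (use that in auto)
  have B: "?P x < ?P y" if "i+m+1 \<le> x" "x < y" "y \<le> i+2*m" for x y
  proof (rule before)
    have "set (take (?P y) W) \<inter> {i+m+1..i+2*m} = {i+m+1..<y}"
      using inv pos[of y] that unfolding dyck_inv_def by simp
    moreover have "x \<in> {i+m+1..<y}" using that by simp
    ultimately show "x \<in> set (take (?P y) W)" by blast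
  qed (use that in auto)
  have km: "k \<le> m" and u: "u < length W" "W ! u = i+k" using um unfolding unmatched_at_def by auto
  have uP: "u = ?P (i+k)" using wpos_nth[OF w(1) u(1)] u(2) by simp
  have lh: "(j < k \<longrightarrow> i+m+1+j \<in> set (take (?P (i+j)) W)) \<and> (k < j \<longrightarrow> i+m+j \<in> set (take (?P (i+j)) W))"
    if "j \<le> m" for j
    using um pos[of "i+j"] that unfolding unmatched_at_def by simp
  have "dyck_order ?P N i m k"
  proof
    show "inj_on ?P {1..N}" using wpos_inj[OF w(1)] w(2) by (auto intro: inj_onI)
    show "?P (i+m+1+j) < ?P (i+j)" if "j < k" for j
      by (rule before) (use lh[of j] that km in auto)
    show "?P (i+m+j) < ?P (i+j)" if "k < j" "j \<le> m" for j
      by (rule before) (use lh[of j] that km in auto)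
    show "?P (i+k) < ?P (i+m+1+k)" if "k < m"
    proof -
      have "i+m+1+k \<notin> set (take u W)" using um that unfolding unmatched_at_def by simp
      then have "\<not> ?P (i+m+1+k) < ?P (i+k)"
        using in_set_take_iff_wpos[OF w(1) inW, of "i+m+1+k" u] that u(1) uP by simp
      moreover have "?P (i+m+1+k) \<noteq> ?P (i+k)" using wpos_inj[OF w(1) inW inW, of "i+m+1+k" "i+k"] that by simp
      ultimately show ?thesis by simp
    qed
  qed (use b km A B in auto)
  moreover have "unbr i 0 0 (map (dyck_letter i m) W) = [?P (i+k)]"
    using um uP unfolding unmatched_at_def by simp
  ultimately show thesis using that[of k] unfolding W_def N_def by blast
qed

lemma std_nth:
  assumes "t < length w"
  shows "std w ! t = Suc (card {p. p < length w \<and> (w ! p < w ! t \<or> w ! p = w ! t \<and> p < t)})"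
proof -
  have "{p. p < length w \<and> (w ! p < w ! t \<or> w ! p = w ! t \<and> p < t)} =
    {p. p < length w \<and> w ! p < w ! t} \<union> {p. p < t \<and> w ! p = w ! t}" using assms by auto
  moreover have "card ({p. p < length w \<and> w ! p < w ! t} \<union> {p. p < t \<and> w ! p = w ! t}) =
    card {p. p < length w \<and> w ! p < w ! t} + card {p. p < t \<and> w ! p = w ! t}"
    by (rule card_Un_disjoint) auto
  ultimately show ?thesis using assms unfolding std_def by simp
qed

text \<open>The crystal operator turns a_k into \<open>Suc i\<close>. Under standardization the a's
  after a_k shift down by one, b_1, ..., b_k shift down by one to start at i+m, and a_k, read
  between b_k and b_{k+1}, receives i+m+k. This is the cycle encoded by \<open>src\<close>.\<close>

lemma std_relabel:
  assumes syt: "is_SYT lam T" and ord: "dyck_order (wpos (rowword T)) (sum_list lam) i m k"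
    and d: "d \<in> {1..sum_list lam}"
  shows "std ((map (dyck_letter i m) (rowword T))[wpos (rowword T) (i+k) := Suc i])
    ! wpos (rowword T) (dyck_order.src i m k d) = d"
proof -
  define W where "W = rowword T"
  define N where "N = sum_list lam"
  note w = SYT_rowword[OF syt, folded W_def N_def]
  interpret dyck_order "wpos W" N i m k using ord unfolding W_def N_def .
  let ?P = "wpos W"
  define v where "v = (map (dyck_letter i m) W)[?P (i+k) := Suc i]"
  have lv: "length v = N" unfolding v_def using w(3) by simp
  have src: "src e \<in> {1..N}" if "e \<in> {1..N}" for e using src_bij that unfolding bij_betw_def by blast
  have pos: "?P e < N" "W ! ?P e = e" if "e \<in> {1..N}" for e
    using wpos_less[OF w(1)] nth_wpos[OF w(1)] that w(2,3) by auto
  \<comment> \<open>The letter, in the altered word, of the cell labelled \<open>e\<close> in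
    \<open>T'\<close>: the crystal operator leaves \<open>m\<close> letters \<open>i\<close> and
    \<open>m+1\<close> letters \<open>Suc i\<close>.\<close>
  define L where "L e = (if e < i then e else if e < i+m then i else if e \<le> i+2*m then Suc i else e)" for e
  have ik: "i+k \<in> {1..N}" using i N k by auto
  have vL: "v ! ?P (src e) = L e" if e: "e \<in> {1..N}" for e
  proof (cases "src e = i+k")
    case True
    then have "e = i+m+k" using m unfolding src_def by (auto split: if_splits)
    then show ?thesis using True k m pos[OF ik] lv unfolding v_def L_def by simp
  next
    case False
    then have "?P (src e) \<noteq> ?P (i+k)" using ne[OF src[OF e] ik] by simp
    then have "v ! ?P (src e) = dyck_letter i m (src e)"
      unfolding v_def using pos[OF src[OF e]] w(3) by simp
    also have "\<dots> = L e" using False m k unfolding dyck_letter_def L_def src_def by auto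
    finally show ?thesis .
  qed
  define less where "less p t \<longleftrightarrow> v ! p < v ! t \<or> v ! p = v ! t \<and> p < t" for p t
  have mono: "less (?P (src e)) (?P (src e'))" if e: "e \<in> {1..N}" "e' \<in> {1..N}" "e < e'" for e e'
  proof -
    have "L e < L e' \<or> L e = L e' \<and> (i \<le> e \<and> e' < i+m \<or> i+m \<le> e \<and> e' \<le> i+2*m)"
      using e(3) m unfolding L_def by auto
    then show ?thesis unfolding less_def vL[OF e(1)] vL[OF e(2)]
      using src_order_A[of e e'] src_order_B[of e e'] e(3) by auto
  qed
  have dN: "d \<in> {1..N}" using d unfolding N_def .
  \<comment> \<open>By \<open>mono\<close>, the positions ranked before that of \<open>src d\<close>
    are those of \<open>src 1\<close>, ..., \<open>src (d-1)\<close>, so its rank is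
    \<open>d\<close>.\<close>
  have "{p. p < N \<and> less p (?P (src d))} = (\<lambda>e. ?P (src e)) ` {1..<d}"
  proof (intro equalityI subsetI)
    fix p assume "p \<in> {p. p < N \<and> less p (?P (src d))}"
    then have p: "p < N" "less p (?P (src d))" by auto
    have "W ! p \<in> {1..N}" using p(1) w(2,3) nth_mem[of p W] by simp
    then obtain e where e: "e \<in> {1..N}" "src e = W ! p" using src_bij unfolding bij_betw_def by (metis imageE)
    have pe: "p = ?P (src e)" using e(2) wpos_nth[OF w(1), of p] p(1) w(3) by simp
    have "e < d"
    proof (rule ccontr)
      assume "\<not> e < d"
      then consider "e = d" | "d < e" by linarith
      then show False
      proof cases
        case 1 then show ?thesis using p pe unfolding less_def by simp
      next
        case 2
        then show ?thesis using mono[OF dN e(1)] p pe unfolding less_def by auto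
      qed
    qed
    then show "p \<in> (\<lambda>e. ?P (src e)) ` {1..<d}" using pe e(1) by auto
  next
    fix p assume "p \<in> (\<lambda>e. ?P (src e)) ` {1..<d}"
    then obtain e where e: "e \<in> {1..<d}" "p = ?P (src e)" by auto
    then have "e \<in> {1..N}" using dN by auto
    then show "p \<in> {p. p < N \<and> less p (?P (src d))}" using mono[OF _ dN] pos[OF src] e by auto
  qed
  moreover have "card ((\<lambda>e. ?P (src e)) ` {1..<d}) = d - 1"
  proof -
    have "inj_on (\<lambda>e. ?P (src e)) {1..<d}"
    proof (rule inj_onI)
      fix x y assume xy: "x \<in> {1..<d}" "y \<in> {1..<d}" "?P (src x) = ?P (src y)"
      have "x \<in> {1..N}" "y \<in> {1..N}" using xy dN by auto
      then show "x = y" using ne[OF src src] xy(3) src_bij unfolding bij_betw_def inj_on_def by metis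
    qed
    then show ?thesis using card_image by fastforce
  qed
  ultimately have "card {p. p < N \<and> less p (?P (src d))} = d - 1" by simp
  moreover have "std v ! ?P (src d) = Suc (card {p. p < N \<and> less p (?P (src d))})"
    using std_nth[of "?P (src d)" v] pos(1)[OF src[OF dN]] lv unfolding less_def by simp
  ultimately have "std v ! ?P (src d) = d" using dN by simp
  then show ?thesis unfolding v_def W_def .
qed

lemma concat_split_lens: "length w = sum_list ls \<Longrightarrow> concat (split_lens ls w) = w"
  by (induction ls arbitrary: w) auto

lemma rowword_unrow:
  assumes "length w = sum_list lam" shows "rowword (unrow lam w) = w"
  unfolding rowword_def unrow_def using concat_split_lens[of w "rev lam"] assms by (simp add: sum_list_rev)

lemma cs_edge_descents:
  assumes edge: "cs_edge lam T i m T'"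
  obtains k where "dyck_order (wpos (rowword T)) (sum_list lam) i m k"
    and "descents T = dyck_order.desc (wpos (rowword T)) (sum_list lam)"
    and "descents T' = dyck_order.desc' (wpos (rowword T)) (sum_list lam) i m k"
proof -
  have syt: "is_SYT lam T" and syt': "is_SYT lam T'" and dyck: "dyck_interval (rowword T) i m"
    using edge unfolding cs_edge_def by auto
  obtain k where ord: "dyck_order (wpos (rowword T)) (sum_list lam) i m k"
    and U: "unbr i 0 0 (map (dyck_letter i m) (rowword T)) = [wpos (rowword T) (i+k)]"
    using dyck_interval_order[OF syt dyck] .
  interpret dyck_order "wpos (rowword T)" "sum_list lam" i m k by (rule ord)
  let ?P = "wpos (rowword T)"
  let ?v = "(map (dyck_letter i m) (rowword T))[?P (i+k) := Suc i]"
  have "rowword (map (map (dyck_letter i m)) T) = map (dyck_letter i m) (rowword T)"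
    unfolding rowword_def by (simp add: rev_map map_concat)
  then have T': "T' = unrow lam (std ?v)"
    using edge U unfolding cs_edge_def crystal_f_def Let_def dyck_letter_def[abs_def] by auto
  have "length (std ?v) = sum_list lam" unfolding std_def using SYT_rowword(3)[OF syt] by simp
  then have rw: "rowword T' = std ?v" using T' rowword_unrow by simp
  have pos': "wpos (rowword T') d = ?P (src d)" if "d \<in> {1..sum_list lam}" for d
  proof -
    have "src d \<in> {1..sum_list lam}" using src_bij that unfolding bij_betw_def by blast
    then have "?P (src d) < length (rowword T')"
      using wpos_less[OF SYT_rowword(1)[OF syt]] SYT_rowword(2,3)[OF syt] SYT_rowword(3)[OF syt'] by simp
    then show ?thesis
      using wpos_nth[OF SYT_rowword(1)[OF syt']] std_relabel[OF syt ord that] rw by metis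
  qed
  have "descents T = desc" unfolding SYT_descents[OF syt] desc_def ..
  moreover have "descents T' = desc'" unfolding SYT_descents[OF syt'] desc'_def using pos' by auto
  ultimately show thesis using that[OF ord] by blast
qed

lemma SYT_inc_chain_iff:
  assumes "is_SYT lam T" "V \<subseteq> {1..sum_list lam}"
  shows "inc_chain V (row_of T) n \<longleftrightarrow>
    (\<exists>S\<subseteq>V. card S = n \<and> (\<forall>x\<in>S. \<forall>y\<in>S. x < y \<longrightarrow> wpos (rowword T) x < wpos (rowword T) y))"
proof -
  have *: "(\<forall>x\<in>S. \<forall>y\<in>S. x < y \<longrightarrow> row_of T y \<le> row_of T x) \<longleftrightarrow>
    (\<forall>x\<in>S. \<forall>y\<in>S. x < y \<longrightarrow> wpos (rowword T) x < wpos (rowword T) y)" if "S \<subseteq> V" for S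
    using SYT_row_le_iff[OF assms(1)] that assms(2) by (meson subsetD)
  show ?thesis unfolding inc_chain_def by (intro ex_cong1 conj_cong refl *)
qed

lemma SYT_dec_triple_iff:
  assumes "is_SYT lam T" "V \<subseteq> {1..sum_list lam}"
  shows "dec_triple V (row_of T) \<longleftrightarrow> (\<exists>x\<in>V. \<exists>y\<in>V. \<exists>z\<in>V. x < y \<and> y < z \<and>
    wpos (rowword T) z < wpos (rowword T) y \<and> wpos (rowword T) y < wpos (rowword T) x)"
proof -
  have "row_of T x < row_of T y \<longleftrightarrow> wpos (rowword T) y < wpos (rowword T) x" if "x \<in> V" "y \<in> V" "x < y" for x y
  proof -
    have "x \<in> {1..sum_list lam}" "y \<in> {1..sum_list lam}" using that assms(2) by auto
    then have "row_of T y \<le> row_of T x \<longleftrightarrow> wpos (rowword T) x < wpos (rowword T) y"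
      "wpos (rowword T) x \<noteq> wpos (rowword T) y"
      using SYT_row_le_iff[OF assms(1) _ _ that(3)] wpos_inj[OF SYT_rowword(1)[OF assms(1)], of x y] that(3)
        SYT_rowword(2)[OF assms(1)] by simp_all
    then show ?thesis by linarith
  qed
  then show ?thesis unfolding dec_triple_def by meson
qed

lemma has_rect_left_right:
  assumes syt: "is_SYT lam T" and ord: "dyck_order (wpos (rowword T)) (sum_list lam) i m k"
  shows "has_rect T (i-1) (i+2*m) \<longleftrightarrow> dyck_order.left_rect (wpos (rowword T)) i k"
    and "has_rect T i (i+2*m+1) \<longleftrightarrow> dyck_order.right_rect (wpos (rowword T)) (sum_list lam) i m k"
proof -
  interpret dyck_order "wpos (rowword T)" "sum_list lam" i m k by (rule ord)
  show "has_rect T (i-1) (i+2*m) \<longleftrightarrow> left_rect"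
  \<comment> \<open>For \<open>i = 1\<close> the interval starts at 0, and \<open>has_rect\<close>
    fails by its bounds.\<close>
  proof (cases "1 < i")
    case False
    then show ?thesis using i unfolding has_rect_def left_rect_def by auto
  next
    case True
    have sub: "{i-1..i+2*m} \<subseteq> {1..sum_list lam}" using True N by auto
    have "i+2*m + 1 - (i-1) = 2 * (m + 1)" "1 \<le> i-1" "i-1 \<le> i+2*m" using True by auto
    then show ?thesis unfolding has_rect_iff[OF syt] left_rect_iff[OF True] SYT_inc_chain_iff[OF syt sub]
      SYT_dec_triple_iff[OF syt sub] inc_set_def has_dec_def using True N by simp
  qed
  show "has_rect T i (i+2*m+1) \<longleftrightarrow> right_rect"
  proof (cases "i+2*m < sum_list lam")
    case False
    then show ?thesis unfolding has_rect_def right_rect_def SYT_length_concat[OF syt] by auto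
  next
    case True
    have sub: "{i..i+2*m+1} \<subseteq> {1..sum_list lam}" using True i by auto
    have "i+2*m+1 + 1 - i = 2 * (m + 1)" by simp
    then show ?thesis unfolding has_rect_iff[OF syt] right_rect_iff[OF True] SYT_inc_chain_iff[OF syt sub]
      SYT_dec_triple_iff[OF syt sub] inc_set_def has_dec_def using True i by simp
  qed
qed

subsection \<open>Blocks of the descent composition\<close>

text \<open>Blocks computed from their right endpoints, \<open>p\<close> being the endpoint before
  them. Unlike partial sums of a composition this is local: a changed endpoint affects only the
  adjacent blocks.\<close>

fun gaps :: "nat \<Rightarrow> nat list \<Rightarrow> nat set list" where
  "gaps p [] = []"
| "gaps p (q # qs) = {p+1..q} # gaps q qs"

lemma length_gaps [simp]: "length (gaps p qs) = length qs"
  by (induction p qs rule: gaps.induct) auto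

lemma nth_gaps: "n < length qs \<Longrightarrow> gaps p qs ! n = {(p # qs) ! n + 1..qs ! n}"
  by (induction p qs arbitrary: n rule: gaps.induct) (auto simp: nth_Cons split: nat.split)

lemma gaps_append: "gaps p (xs @ ys) = gaps p xs @ gaps (last (p # xs)) ys"
  by (induction p xs rule: gaps.induct) auto

text \<open>Telescoping; sortedness keeps the natural subtraction exact.\<close>

lemma sum_take_differences:
  fixes p :: nat
  assumes "sorted (p # qs)" "j \<le> length qs"
  shows "p + sum_list (take j (map (\<lambda>k. (p # qs) ! Suc k - (p # qs) ! k) [0..<length qs])) = (p # qs) ! j"
  using assms(2)
proof (induction j)
  case (Suc j)
  let ?d = "map (\<lambda>k. (p # qs) ! Suc k - (p # qs) ! k) [0..<length qs]"
  have le: "(p # qs) ! j \<le> (p # qs) ! Suc j" using sorted_nth_mono[OF assms(1), of j "Suc j"] Suc.prems by simp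
  have "sum_list (take (Suc j) ?d) = sum_list (take j ?d) + ((p # qs) ! Suc j - (p # qs) ! j)"
    using Suc.prems by (simp add: take_Suc_conv_app_nth)
  moreover have "p + sum_list (take j ?d) = (p # qs) ! j" using Suc by simp
  ultimately have "p + sum_list (take (Suc j) ?d) = (p # qs) ! j + ((p # qs) ! Suc j - (p # qs) ! j)"
    by (simp only: add.assoc[symmetric])
  also have "\<dots> = (p # qs) ! Suc j" by (rule le_add_diff_inverse[OF le])
  finally show ?case .
qed simp

text \<open>The right endpoints of the blocks of \<open>Des T\<close>; the last one, the size of
  \<open>T\<close>, is adjoined because it is not a descent.\<close>

definition break_points :: "tableau \<Rightarrow> nat list" where
  "break_points T = sorted_list_of_set (insert (length (concat T)) (descents T))"

lemma finite_descents: "finite (descents T)"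
  by (rule finite_subset[of _ "{..length (concat T)}"]) (auto simp: descents_def)

lemma set_break_points: "set (break_points T) = insert (length (concat T)) (descents T)"
  unfolding break_points_def by (rule set_sorted_list_of_set) (use finite_descents in simp)

lemma strict_sorted_break_points: "sorted_wrt (<) (break_points T)"
  unfolding break_points_def by simp

lemma break_points_eqI:
  assumes "sorted_wrt (<) xs" "set xs = insert (length (concat T)) (descents T)"
  shows "break_points T = xs"
  unfolding break_points_def assms(2)[symmetric]
  using assms(1) by (simp add: sorted_list_of_set.idem_if_sorted_distinct strict_sorted_iff)

lemma Des_break_points:
  "Des T = map (\<lambda>k. (0 # break_points T) ! Suc k - (0 # break_points T) ! k) [0..<length (break_points T)]"
proof -
  let ?xs = "sorted_list_of_set (descents T) @ [length (concat T)]"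
  have "x < length (concat T)" if "x \<in> descents T" for x using that unfolding descents_def by auto
  then have "sorted_wrt (<) ?xs" using finite_descents by (auto simp: sorted_wrt_append)
  then have bp: "break_points T = ?xs" by (rule break_points_eqI) (use finite_descents in auto)
  show ?thesis unfolding Des_def Let_def bp by simp
qed

lemma length_Des: "length (Des T) = length (break_points T)"
  unfolding Des_break_points by simp

lemma blk_Des:
  assumes "n < length (break_points T)"
  shows "blk (Des T) (Suc n) = gaps 0 (break_points T) ! n"
proof -
  have s: "sorted (0 # break_points T)" using strict_sorted_break_points strict_sorted_iff by auto
  have "sum_list (take j (Des T)) = (0 # break_points T) ! j" if "j \<le> length (break_points T)" for j
    using sum_take_differences[OF s that] unfolding Des_break_points by simp
  then show ?thesis unfolding blk_def length_Des nth_gaps[OF assms] using assms by simp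
qed

lemma map_blk_Des:
  assumes "b \<le> length (break_points T)"
  shows "map (blk (Des T)) [Suc a..<Suc b] = drop a (take b (gaps 0 (break_points T)))"
proof (rule nth_equalityI)
  show "length (map (blk (Des T)) [Suc a..<Suc b]) = length (drop a (take b (gaps 0 (break_points T))))"
    using assms by (simp del: upt_Suc)
  fix n assume "n < length (map (blk (Des T)) [Suc a..<Suc b])"
  then have n: "a + n < b" by (simp del: upt_Suc)
  then have "map (blk (Des T)) [Suc a..<Suc b] ! n = blk (Des T) (Suc (a + n))"
    by (simp del: upt_Suc)
  then show "map (blk (Des T)) [Suc a..<Suc b] ! n = drop a (take b (gaps 0 (break_points T))) ! n"
    using blk_Des[of "a + n" T] n assms by simp
qed

lemma blocks_Des: "blocks (Des T) = gaps 0 (break_points T)"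
  unfolding blocks_def length_Des using map_blk_Des[of "length (break_points T)" T 0] by simp

theorem theorem4p26:
  fixes lam :: "nat list" and T T' :: tableau and i m j :: nat
  assumes "is_SYT lam T" and "is_SYT lam T'"
    and "cs_edge lam T i m T'"
    and "{i..i+m} \<subseteq> blk (Des T) j"
  shows
    "let \<alpha> = Des T; \<beta> = Des T'; l = length \<alpha>;
         pre = map (blk \<alpha>) [1..<j-1];
         prev = (if 2 \<le> j then [blk \<alpha> (j-1)] else []);
         suf = map (blk \<alpha>) [j+2..<l+1]
     in (\<not> has_rect T (i-1) (i+2*m) \<and> \<not> has_rect T i (i+2*m+1) \<longrightarrow>
           length \<beta> = l \<and>
           blocks \<beta> = pre @ prev @ [blk \<alpha> j - {i+m}, blk \<alpha> (j+1) \<union> {i+m}] @ suf)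
      \<and> (has_rect T i (i+2*m+1) \<longrightarrow>
           length \<beta> = l + 1 \<and>
           blocks \<beta> = pre @ prev @ [blk \<alpha> j - {i+m}, {i+m+1..i+2*m} \<union> {i+m},
                                    blk \<alpha> (j+1) - {i+m+1..i+2*m}] @ suf)
      \<and> (has_rect T (i-1) (i+2*m) \<longrightarrow>
           blk \<alpha> j = {i..i+m-1} \<union> {i+m} \<and>
           length \<beta> + 1 = l \<and>
           blocks \<beta> = pre @ [blk \<alpha> (j-1) \<union> {i..i+m-1}, blk \<alpha> (j+1) \<union> {i+m}] @ suf)"
proof -
  define N where "N = sum_list lam"
  obtain k where ord: "dyck_order (wpos (rowword T)) N i m k"
    and D: "descents T = dyck_order.desc (wpos (rowword T)) N"
    and D': "descents T' = dyck_order.desc' (wpos (rowword T)) N i m k"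
    using cs_edge_descents[OF assms(3)] unfolding N_def by blast
  interpret dyck_order "wpos (rowword T)" N i m k by (rule ord)
  note rects = has_rect_left_right[OF assms(1) ord[unfolded N_def], folded N_def]
  define q where "q = break_points T"
  have sq: "set q = insert N desc" and sorted_q: "sorted_wrt (<) q"
    unfolding q_def using set_break_points D SYT_length_concat[OF assms(1)] strict_sorted_break_points N_def by auto
  have bpI: "break_points T' = xs" if "sorted_wrt (<) xs" "set xs = insert N desc'" for xs
    using break_points_eqI[OF that(1)] that(2) D' SYT_length_concat[OF assms(2)] N_def by simp
  have j: "1 \<le> j" "j \<le> length q"
    using assms(4) unfolding blk_def length_Des q_def by (auto split: if_splits)
  obtain n where n: "j = Suc n" using j(1) by (cases j) auto
  have nq: "n < length q" using j n by simp
  have blkj: "blk (Des T) j = {(0 # q) ! n + 1..q ! n}"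
    using blk_Des[of n T] nth_gaps[of n q 0] nq n unfolding q_def by simp
  have "i \<in> blk (Des T) j" "i+m \<in> blk (Des T) j" using assms(4) by auto
  then have lo_n: "(0 # q) ! n < i" and hi_n: "i+m \<le> q ! n" unfolding blkj by auto
  have Q_less: "x < i" if x: "x \<in> set (take n q)" for x
  proof -
    obtain a where a: "a < n" "x = q ! a" using x by (auto simp: in_set_conv_nth)
    then have "q ! a \<le> q ! (n - 1)"
    proof (cases "a = n - 1")
      case False
      then have "a < n - 1" "n - 1 < length q" using a(1) nq by linarith+
      then show ?thesis using sorted_wrt_nth_less[OF sorted_q, of a "n - 1"] by simp
    qed simp
    then show ?thesis using a lo_n by (cases n) auto
  qed
  \<comment> \<open>Since i+m is a descent of \<open>T\<close> and lies in block \<open>j\<close>,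
    it is the right endpoint of that block.\<close>
  have "q ! n = i+m"
  proof -
    have "i+m \<in> set q" using sq desc_facts(2) by simp
    then obtain a where a: "a < length q" "q ! a = i+m" by (metis in_set_conv_nth)
    have "\<not> a < n"
    proof
      assume "a < n"
      then have "q ! a \<in> set (take n q)" using nq by (auto simp: in_set_conv_nth)
      then show False using Q_less a(2) by fastforce
    qed
    moreover have "\<not> n < a" using sorted_wrt_nth_less[OF sorted_q _ a(1), of n] a(2) hi_n by auto
    ultimately show ?thesis using a(2) by (cases "a = n") auto
  qed
  define Q where "Q = take n q"
  define R where "R = drop (Suc n) q"
  have qQR: "q = Q @ (i+m) # R" unfolding Q_def R_def using id_take_nth_drop[OF nq] \<open>q ! n = i+m\<close> by simp
  have lenQ: "length Q = n" unfolding Q_def using nq by simp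
  have R_gt: "i+m < x" if "x \<in> set R" for x using sorted_q that unfolding qQR by (auto simp: sorted_wrt_append)
  \<comment> \<open>No descent lies strictly between i+m and i+2m, so block \<open>j+1\<close>
    contains all of \<open>{i+m+1..i+2*m}\<close>.\<close>
  have R_ge: "i+2*m \<le> x" if x: "x \<in> set R" for x
  proof (rule ccontr)
    assume "\<not> i+2*m \<le> x"
    then have "x \<notin> desc" "x \<noteq> N" using desc_facts(3)[of x] R_gt[OF x] N by auto
    then show False using x sq unfolding qQR by auto
  qed
  have Nq: "N \<in> set q" using sq by simp
  have QN: "N \<notin> set Q" using Q_less N m unfolding Q_def by fastforce
  \<comment> \<open>The size \<open>N\<close> is an endpoint beyond i+m, so block \<open>j+1\<close>
    exists.\<close>
  then have "N \<in> set R" using Nq N m unfolding qQR by auto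
  then obtain h R' where R: "R = h # R'" by (cases R) auto
  let ?l = "last (0 # Q)"
  have l: "?l < i" using Q_less i unfolding Q_def[symmetric] by auto
  have gq: "gaps 0 q = gaps 0 Q @ [{?l + 1..i+m}, {i+m+1..h}] @ gaps h R'"
    unfolding qQR R by (simp add: gaps_append)
  have lq: "length q = length Q + 2 + length R'" unfolding qQR R by simp
  have bj: "blk (Des T) j = {?l + 1..i+m}"
    using blk_Des[of n T] nq n gq lenQ unfolding q_def[symmetric] by (simp add: nth_append)
  have bj1: "blk (Des T) (j + 1) = {i+m+1..h}"
    using blk_Des[of "Suc n" T] n gq lenQ lq unfolding q_def[symmetric] by (simp add: nth_append)
  have suf: "map (blk (Des T)) [j+2..<length (Des T)+1] = gaps h R'"
    using map_blk_Des[of "length q" T "j+1"] gq lq lenQ n unfolding length_Des q_def[symmetric] by simp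
  have pp: "map (blk (Des T)) [1..<j-1] @ (if 2 \<le> j then [blk (Des T) (j-1)] else []) = gaps 0 Q"
  proof -
    have "map (blk (Des T)) [1..<j-1] @ (if 2 \<le> j then [blk (Des T) (j-1)] else []) = map (blk (Des T)) [Suc 0..<Suc n]"
      using n by (cases n) simp_all
    then show ?thesis using map_blk_Des[of n T 0] nq gq lenQ unfolding q_def[symmetric] by simp
  qed
  \<comment> \<open>On endpoints, the edge moves i+m to i+m-1, deletes i-1 for a left rectangle and
    adds i+2m for a right one.\<close>
  have set_q': "insert N desc' = (set q - {i+m} - (if left_rect then {i-1} else {})) \<union> {i+m-1}
      \<union> (if right_rect then {i+2*m} else {})"
  proof (rule set_eqI)
    fix d
    have mem: "d \<in> insert N desc' \<longleftrightarrow> d = N \<or> d \<in> desc'" "d \<in> set q \<longleftrightarrow> d = N \<or> d \<in> desc" unfolding sq by auto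
    consider "d < i-1" | "d = i-1" "i-1 < i" | "i \<le> d" "d < i+m-1" | "d = i+m-1" | "i+m \<le> d" "d < i+2*m" | "d = i+2*m" | "i+2*m < d"
      using i by linarith
    then show "d \<in> insert N desc' \<longleftrightarrow> d \<in> (set q - {i+m} - (if left_rect then {i-1} else {})) \<union> {i+m-1}
      \<union> (if right_rect then {i+2*m} else {})"
    proof cases
      case 1 then show ?thesis unfolding Un_iff Diff_iff mem using desc'_facts(1)[of d] by auto
    next
      case 2 then show ?thesis unfolding Un_iff Diff_iff mem using desc'_facts(6) m N by auto
    next
      case 3
      then have "d \<notin> desc" "d \<notin> desc'" using desc'_facts(3) desc_facts(1) by auto
      then show ?thesis unfolding Un_iff Diff_iff mem using 3 N m by auto
    next
      case 4 then show ?thesis unfolding Un_iff Diff_iff mem using desc'_facts(4) by auto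
    next
      case 5
      then have "d \<notin> desc'" "d \<noteq> N" "d \<noteq> i+m-1" using desc'_facts(5) N m by auto
      moreover have "d = i+m \<or> d \<notin> desc" using desc_facts(3)[of d] 5 by auto
      ultimately show ?thesis unfolding Un_iff Diff_iff mem using 5 by auto
    next
      case 6 then show ?thesis unfolding Un_iff Diff_iff mem using desc'_facts(7) m by auto
    next
      case 7 then show ?thesis unfolding Un_iff Diff_iff mem using desc'_facts(2)[of d] m by auto
    qed
  qed
  have sQ: "sorted_wrt (<) Q" "sorted_wrt (<) (h # R')"
    using sorted_q unfolding qQR R by (simp_all add: sorted_wrt_append)
  have Qi: "x < i" if "x \<in> set Q" for x using Q_less that unfolding Q_def .
  have Rh: "i+2*m \<le> x" if "x \<in> set (h # R')" for x using R_ge that unfolding R .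
  have minus: "set q - {i+m} = set Q \<union> set (h # R')" using Qi R_gt unfolding qQR R by fastforce
  have c1: "length (Des T') = length (Des T) \<and>
           blocks (Des T') = gaps 0 Q @ [blk (Des T) j - {i+m}, blk (Des T) (j+1) \<union> {i+m}] @ gaps h R'"
    if "\<not> left_rect" "\<not> right_rect"
  proof -
    have "break_points T' = Q @ (i+m-1) # h # R'"
    proof (rule bpI)
      show "sorted_wrt (<) (Q @ (i+m-1) # h # R')"
        using sQ Qi Rh m unfolding sorted_wrt_append by fastforce
    qed (use that minus set_q' in auto)
    moreover have "{?l + 1..i+m} - {i+m} = {?l + 1..i+m-1}" using m by auto
    moreover have "{i+m+1..h} \<union> {i+m} = {i+m-1+1..h}" using Rh[of h] m by auto
    ultimately show ?thesis unfolding blocks_Des length_Des bj bj1 q_def[symmetric] lq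
      by (simp add: gaps_append)
  qed
  have c2: "length (Des T') = length (Des T) + 1 \<and>
           blocks (Des T') = gaps 0 Q @ [blk (Des T) j - {i+m}, {i+m+1..i+2*m} \<union> {i+m},
              blk (Des T) (j+1) - {i+m+1..i+2*m}] @ gaps h R'"
    if r: right_rect
  proof -
    \<comment> \<open>The two rectangles exclude each other, as \<open>k = m \<ge> 1\<close> in one
      case and \<open>k = 0\<close> in the other.\<close>
    have nl: "\<not> left_rect" using r m unfolding left_rect_def right_rect_def by auto
    \<comment> \<open>The added endpoint is new, being neither a descent of \<open>T\<close> nor
      equal to \<open>N\<close>; hence the part of block \<open>j+1\<close> beyond it is
      nonempty.\<close>
    have "i+2*m \<notin> set q" using desc_facts(5) r unfolding sq right_rect_def by auto
    then have Rh': "i+2*m < x" if "x \<in> set (h # R')" for x using Rh[OF that] that unfolding qQR R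
      by (metis Un_iff le_neq_implies_less list.set_intros(2) set_append)
    have "break_points T' = Q @ (i+m-1) # (i+2*m) # h # R'"
    proof (rule bpI)
      show "sorted_wrt (<) (Q @ (i+m-1) # (i+2*m) # h # R')"
        using sQ Qi Rh' m unfolding sorted_wrt_append by fastforce
    qed (use r nl minus set_q' in auto)
    moreover have "{?l + 1..i+m} - {i+m} = {?l + 1..i+m-1}" using m by auto
    moreover have "{i+m+1..i+2*m} \<union> {i+m} = {i+m-1+1..i+2*m}" using m by auto
    moreover have "{i+m+1..h} - {i+m+1..i+2*m} = {i+2*m+1..h}" by auto
    ultimately show ?thesis unfolding blocks_Des length_Des bj bj1 q_def[symmetric] lq
      by (simp add: gaps_append)
  qed
  have c3: "blk (Des T) j = {i..i+m-1} \<union> {i+m} \<and> length (Des T') + 1 = length (Des T) \<and>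
           blocks (Des T') = map (blk (Des T)) [1..<j-1] @
             [blk (Des T) (j-1) \<union> {i..i+m-1}, blk (Des T) (j+1) \<union> {i+m}] @ gaps h R'"
    if r: left_rect
  proof -
    have nr: "\<not> right_rect" using r m unfolding left_rect_def right_rect_def by auto
    \<comment> \<open>As a descent, i-1 is the last endpoint before block \<open>j\<close>. So this
      block starts at \<open>i\<close>, and deleting the endpoint merges what remains of it with
      block \<open>j-1\<close>.\<close>
    have "i-1 \<in> set q" using desc_facts(4) r sq by simp
    then have "i-1 \<in> set Q \<union> set (h # R')" unfolding minus[symmetric] using i by simp
    moreover have iR: "i-1 \<notin> set (h # R')"
    proof
      assume "i-1 \<in> set (h # R')"
      from Rh[OF this] show False using i m by linarith
    qed
    ultimately have iQ: "i-1 \<in> set Q" by blast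
    then have ne: "Q \<noteq> []" by auto
    define Q' where "Q' = butlast Q"
    have Qs: "Q = Q' @ [last Q]" unfolding Q'_def using ne by simp
    have "last Q = i-1"
    proof (rule ccontr)
      assume "last Q \<noteq> i-1"
      then have "i-1 \<in> set Q'" using iQ Qs by (metis Un_iff empty_iff empty_set insert_iff list.simps(15) set_append)
      moreover have "sorted_wrt (<) (Q' @ [last Q])" using sQ(1) Qs by simp
      ultimately have "i-1 < last Q" by (simp add: sorted_wrt_append)
      moreover have "last Q < i" using Qi ne by simp
      ultimately show False by simp
    qed
    then have Qs: "Q = Q' @ [i-1]" using Qs by simp
    have Q'l: "x < i-1" if "x \<in> set Q'" for x using sQ(1) that unfolding Qs by (simp add: sorted_wrt_append)
    then have sQ': "set Q - {i-1} = set Q'" unfolding Qs by auto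
    have sn: "sorted_wrt (<) Q'" using sQ(1) unfolding Qs by (simp add: sorted_wrt_append)
    have lQ': "last (0 # Q') < i" using Q'l[of "last Q'"] i by (cases "Q' = []") auto
    have bp: "break_points T' = Q' @ (i+m-1) # h # R'"
    proof (rule bpI)
      show "sorted_wrt (<) (Q' @ (i+m-1) # h # R')"
        using sn sQ(2) Q'l Rh m unfolding sorted_wrt_append by fastforce
      show "set (Q' @ (i+m-1) # h # R') = insert N desc'"
        using r nr minus set_q' sQ' iR by auto
    qed
    have n': "n = Suc (length Q')" using lenQ Qs by simp
    have gQ: "gaps 0 Q = gaps 0 Q' @ [{last (0 # Q') + 1..i-1}]" unfolding Qs by (simp add: gaps_append)
    have g1: "map (blk (Des T)) [1..<j-1] = gaps 0 Q'"
      using map_blk_Des[of "length Q'" T 0] n n' gq gQ nq unfolding q_def[symmetric] by simp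
    have g2: "blk (Des T) (j-1) = {last (0 # Q') + 1..i-1}"
      using blk_Des[of "length Q'" T] n n' gq gQ nq unfolding q_def[symmetric] by (simp add: nth_append)
    have "{last (0 # Q') + 1..i-1} \<union> {i..i+m-1} = {last (0 # Q') + 1..i+m-1}" using lQ' i m by auto
    moreover have "{i+m+1..h} \<union> {i+m} = {i+m-1+1..h}" using Rh[of h] m by auto
    moreover have "{?l + 1..i+m} = {i..i+m-1} \<union> {i+m}" using i m unfolding Qs by auto
    ultimately show ?thesis unfolding blocks_Des length_Des bj bj1 g1 g2 bp q_def[symmetric] lq
      using lenQ n' by (simp add: gaps_append)
  qed
  show ?thesis unfolding Let_def rects suf append_assoc[symmetric] pp
    using c1 c2 c3 by (simp only: append_assoc simp_thms) blast
qed

end
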